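(* Let $p$ be a prime, $q$ a power of $p$, and $\xi \in \mathbb{F}_q((T^{-1}))$. For every integer $n \ge 1$ we have $w_n^*(\xi) = w_n^@(\xi)$.
   Context: $\mathbb{F}_q$ is the field with $q$ elements. For a nonzero $\xi=\sum_{k\ge N} a_k T^{-k}\in\mathbb{F}_q((T^{-1}))$ with $a_N\neq 0$, set $|\xi|=q^{-N}$, and $|0|=0$; so $|R|=q^{\deg R}$ for nonzero $R\in\mathbb{F}_q[T]$. $C_\infty$ denotes the completion of an algebraic closure of $\mathbb{F}_q((T^{-1}))$, with the extended absolute value. The height $H(P)$ of $P\in\mathbb{F}_q[T][X]$ is the maximum of the absolute values of its coefficients. An element of $C_\infty$ is algebraic if it is a root of a nonzero polynomial in $\mathbb{F}_q[T][X]$; its degree and height $H(\alpha)$ are the degree and height of its minimal defining polynomial over $\mathbb{F}_q[T]$. $w_n^*(\xi)$ is the supremum of the real $w^*$ such that $0<|\xi-\alpha|<H(\alpha)^{-w^*-1}$ has infinitely many solutions in algebraic $\alpha\in\mathbb{F}_q((T^{-1}))$ of degree at most $n$. $w_n^@(\xi)$ is defined the same way but with $\alpha$ ranging over algebraic elements of $C_\infty$ of degree at most $n$. *)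

theory Defs
  imports "HOL-Analysis.Analysis" "HOL-Algebra.Algebraic_Closure_Type"
begin

text \<open>
  The finite field is an arbitrary type \<open>'a :: {field, finite}\<close>, with \<open>q = CARD('a)\<close>. The field of
  Laurent series in \<open>1/T\<close> over it is \<open>'a fls\<close>: the variable \<^term>\<open>fls_X\<close> plays the role of
  \<open>1/T\<close> and \<^term>\<open>fls_X_inv\<close> that of \<open>T\<close>, so that \<^term>\<open>fls_subdegree\<close> is the index \<open>N\<close> of the
  leading term \<open>a_N T^(-N)\<close>. Polynomials in \<open>T\<close> are of type \<open>'a poly\<close>, polynomials in \<open>X\<close> over
  them of type \<open>'a poly poly\<close>.
\<close>

definition fls_abs :: "'a::{field,finite} fls \<Rightarrow> real" where
  "fls_abs \<xi> = (if \<xi> = 0 then 0 else real CARD('a) powr (- real_of_int (fls_subdegree \<xi>)))"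

definition poly_to_fls :: "'a::field poly \<Rightarrow> 'a fls" where
  "poly_to_fls R = Polynomial.poly (map_poly fls_const R) fls_X_inv"

definition height :: "'a::{field,finite} poly poly \<Rightarrow> real" where
  "height P = Max ((\<lambda>i. fls_abs (poly_to_fls (Polynomial.coeff P i))) ` {..Polynomial.degree P})"


text \<open>
  The following notions are relative to a field \<open>'k\<close> containing the polynomials in \<open>T\<close> through an
  embedding \<open>\<phi>\<close>; they are used both for the Laurent series field and for \<open>C\<^sub>\<infinity>\<close>.
\<close>

definition eval_at :: "('a::field poly \<Rightarrow> 'k::field) \<Rightarrow> 'a poly poly \<Rightarrow> 'k \<Rightarrow> 'k" where
  "eval_at \<phi> P \<alpha> = Polynomial.poly (map_poly \<phi> P) \<alpha>"

definition algebraic_via :: "('a::field poly \<Rightarrow> 'k::field) \<Rightarrow> 'k \<Rightarrow> bool" where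
  "algebraic_via \<phi> \<alpha> \<longleftrightarrow> (\<exists>P. P \<noteq> 0 \<and> eval_at \<phi> P \<alpha> = 0)"

text \<open>
  A minimal defining polynomial: of least degree among the nonzero polynomials vanishing at \<open>\<alpha>\<close>,
  and with coprime coefficients. It is unique up to a factor that is a nonzero constant of the
  finite field, which changes neither degree nor height; hence the choice made in \<open>min_poly\<close>
  is immaterial.
\<close>

definition is_min_poly :: "('a::field poly \<Rightarrow> 'k::field) \<Rightarrow> 'k \<Rightarrow> 'a poly poly \<Rightarrow> bool" where
  "is_min_poly \<phi> \<alpha> P \<longleftrightarrow>
     P \<noteq> 0 \<and> eval_at \<phi> P \<alpha> = 0 \<and>
     (\<forall>Q. Q \<noteq> 0 \<longrightarrow> eval_at \<phi> Q \<alpha> = 0 \<longrightarrow> Polynomial.degree P \<le> Polynomial.degree Q) \<and>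
     (\<forall>D. (\<forall>i. D dvd Polynomial.coeff P i) \<longrightarrow> D dvd 1)"

definition min_poly :: "('a::field poly \<Rightarrow> 'k::field) \<Rightarrow> 'k \<Rightarrow> 'a poly poly" where
  "min_poly \<phi> \<alpha> = (SOME P. is_min_poly \<phi> \<alpha> P)"

definition alg_degree :: "('a::field poly \<Rightarrow> 'k::field) \<Rightarrow> 'k \<Rightarrow> nat" where
  "alg_degree \<phi> \<alpha> = Polynomial.degree (min_poly \<phi> \<alpha>)"

definition alg_height :: "('a::{field,finite} poly \<Rightarrow> 'k::field) \<Rightarrow> 'k \<Rightarrow> real" where
  "alg_height \<phi> \<alpha> = height (min_poly \<phi> \<alpha>)"

text \<open>The supremum is taken in the extended reals, as it may be \<open>\<infinity>\<close>.\<close>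

definition approx_exponent ::
    "('a::{field,finite} poly \<Rightarrow> 'k::field) \<Rightarrow> ('k \<Rightarrow> real) \<Rightarrow> nat \<Rightarrow> 'k \<Rightarrow> ereal" where
  "approx_exponent \<phi> av n \<xi> =
     Sup (ereal ` {w. infinite {\<alpha>. algebraic_via \<phi> \<alpha> \<and> alg_degree \<phi> \<alpha> \<le> n \<and>
                                  0 < av (\<xi> - \<alpha>) \<and> av (\<xi> - \<alpha>) < alg_height \<phi> \<alpha> powr (- w - 1)}})"


text \<open>
  \<open>C\<^sub>\<infinity>\<close>, given up to isometric isomorphism as a completion of the algebraic closure of the field of
  Laurent series: a complete field \<open>'c\<close> with an absolute value \<open>av\<close> inducing its metric, in which
  the algebraic closure embeds densely by a field homomorphism \<open>\<iota>\<close> such that \<open>av\<close> extends the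
  absolute value of Laurent series. Completeness is the class \<^class>\<open>complete_space\<close>; definiteness
  and the triangle inequality for \<open>av\<close> are contained in \<open>dist_av\<close>.
\<close>

locale C_infinity =
  fixes \<iota> :: "'a::{field,finite} fls alg_closure \<Rightarrow> 'c::{field,complete_space}"
    and av :: "'c \<Rightarrow> real"
  assumes \<iota>_add: "\<iota> (x + y) = \<iota> x + \<iota> y"
    and \<iota>_mult: "\<iota> (x * y) = \<iota> x * \<iota> y"
    and \<iota>_one: "\<iota> 1 = 1"
    and dist_av: "dist a b = av (a - b)"
    and av_mult: "av (a * b) = av a * av b"
    and av_extends: "av (\<iota> (to_ac \<xi>)) = fls_abs \<xi>"
    and \<iota>_dense: "closure (range \<iota>) = UNIV"
begin

lemma av_eq_0_iff: "av a = 0 \<longleftrightarrow> a = 0"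
  using dist_av[of a 0] dist_eq_0_iff[of a 0] by simp

lemma av_nonneg: "av a \<ge> 0"
  using dist_av[of a 0] zero_le_dist[of a 0] by simp

lemma av_triangle: "av (a + b) \<le> av a + av b"
  using dist_triangle[of a "- b" 0] dist_av[of a "- b"] dist_av[of a 0] dist_av[of 0 "- b"] by simp

end

definition w_star :: "nat \<Rightarrow> 'a::{field,finite} fls \<Rightarrow> ereal" where
  "w_star n \<xi> = approx_exponent poly_to_fls fls_abs n \<xi>"

definition w_at ::
    "('a::{field,finite} fls alg_closure \<Rightarrow> 'c::{field,complete_space}) \<Rightarrow> ('c \<Rightarrow> real) \<Rightarrow>
       nat \<Rightarrow> 'a fls \<Rightarrow> ereal" where
  "w_at \<iota> av n \<xi> = approx_exponent (\<lambda>R. \<iota> (to_ac (poly_to_fls R))) av n (\<iota> (to_ac \<xi>))"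


text \<open>Explicit form of the embedding of the polynomials in \<open>T\<close> and of their absolute value.\<close>

lemma nth_poly_to_fls:
  "fls_nth (poly_to_fls R) k = (if k \<le> 0 then Polynomial.coeff R (nat (- k)) else 0)"
proof (induction R arbitrary: k)
  case 0
  then show ?case by (simp add: poly_to_fls_def)
next
  case (pCons a R)
  have "poly_to_fls (pCons a R) = fls_const a + fls_X_inv * poly_to_fls R"
    using pCons.hyps by (simp add: poly_to_fls_def map_poly_pCons)
  then have "fls_nth (poly_to_fls (pCons a R)) k = (if k = 0 then a else 0) + fls_nth (poly_to_fls R) (k + 1)"
    by (simp add: fls_X_inv_times_conv_shift)
  moreover have "nat (- k) = Suc (nat (- (k + 1)))" if "k < 0"
    using that by simp
  ultimately show ?case
    using pCons.IH[of "k + 1"] by (auto simp: coeff_pCons split: nat.splits)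
qed

lemma fls_abs_poly_to_fls:
  fixes R :: "'a::{field,finite} poly"
  assumes "R \<noteq> 0"
  shows "fls_abs (poly_to_fls R) = real CARD('a) ^ Polynomial.degree R"
proof -
  have lead: "fls_nth (poly_to_fls R) (- int (Polynomial.degree R)) \<noteq> 0"
    using assms by (simp add: nth_poly_to_fls)
  then have "fls_subdegree (poly_to_fls R) = - int (Polynomial.degree R)"
    by (intro fls_subdegree_eqI) (auto simp: nth_poly_to_fls intro!: coeff_eq_0)
  moreover from lead have "poly_to_fls R \<noteq> 0"
    by auto
  ultimately show ?thesis
    by (simp add: fls_abs_def powr_realpow)
qed

end

theory Submission
  imports Defs "Subresultants.Subresultant"
begin

text \<open>
  Only approximations \<open>\<alpha>\<close> outside the field \<open>K\<close> of Laurent series need attention. By Newton's method,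
  the minimal polynomial \<open>P\<close> of such an \<open>\<alpha>\<close> has a second root (counted with multiplicity, so that
  inseparable \<open>\<alpha>\<close> are included) at distance at most \<open>|\<xi> - \<alpha>|\<close> from \<open>\<xi>\<close>. With \<open>H = H(\<alpha>)\<close>, the
  pigeonhole principle gives a nonzero \<open>Q\<close> of degree at most \<open>n\<close> and height less than \<open>H\<close> with
  \<open>|Q(\<xi>)| \<le> \<kappa> H^(-n)\<close>. If all roots of \<open>Q\<close> were farther from \<open>\<xi>\<close> than \<open>\<alpha>\<close>, then \<open>|Q|\<close> would take the
  value \<open>|Q(\<xi>)|\<close> at both roots of \<open>P\<close>, and the resultant, a nonzero polynomial in \<open>T\<close>, would satisfy
  \<open>1 \<le> |Res(P,Q)| \<le> |Q(\<xi>)|^2 H^n H^(n-2) \<le> \<kappa>^2 H^(-2)\<close>, which fails for large \<open>H\<close>. So some algebraic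
  element of smaller height is at least as close to \<open>\<xi>\<close>, and iterating leads to one in \<open>K\<close>.

  The descent could end in \<open>\<xi>\<close> itself if \<open>\<xi>\<close> is algebraic of degree \<open>r \<le> n\<close>. In that case both
  exponents are \<open>r - 1\<close>: the upper bound is Liouville's inequality, and the lower bound comes from
  roots in \<open>K\<close> of perturbations of multiples of the minimal polynomial of \<open>\<xi>\<close>, which is separable.
\<close>

hide_const (open) up_ring.coeff up_ring.monom module.smult Polynomials.degree
  Polynomials.lead_coeff Divisibility.irreducible Divisibility.prime Coset.order

subsection \<open>Ultrametric norms on a field\<close>

locale ultrametric_norm =
  fixes N :: "'l::field \<Rightarrow> real"
  assumes N_nonneg: "0 \<le> N x"
    and N_eq_0_iff [simp]: "N x = 0 \<longleftrightarrow> x = 0"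
    and N_mult: "N (x * y) = N x * N y"
    and N_add_le: "N (x + y) \<le> max (N x) (N y)"
begin

lemma N_0 [simp]: "N 0 = 0"
  by simp

lemma N_pos: "x \<noteq> 0 \<Longrightarrow> 0 < N x"
  using N_nonneg[of x] N_eq_0_iff[of x] by linarith

lemma N_1 [simp]: "N 1 = 1"
  using N_mult[of 1 1] by simp

lemma N_neg_1: "N (- 1) = 1"
proof -
  have "N (- 1) * N (- 1) = 1"
    using N_mult[of "- 1" "- 1"] by simp
  then show ?thesis
    using N_nonneg[of "- 1"] by (metis abs_of_nonneg abs_1 abs_mult_self_eq real_sqrt_abs2 real_sqrt_one)
qed

lemma N_minus [simp]: "N (- x) = N x"
  using N_mult[of "- 1" x] by (simp add: N_neg_1)

lemma N_diff_le: "N (x - y) \<le> max (N x) (N y)"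
  using N_add_le[of x "- y"] by simp

lemma N_minus_commute: "N (x - y) = N (y - x)"
  using N_minus[of "x - y"] by simp

lemma N_power: "N (x ^ n) = N x ^ n"
  by (induction n) (simp_all add: N_mult)

lemma N_divide: "N (x / y) = N x / N y"
proof (cases "y = 0")
  case False
  then have "N (x / y) * N y = N x"
    by (simp flip: N_mult)
  then show ?thesis
    using False by (simp add: field_simps)
qed simp

lemma N_sum_le:
  assumes "\<And>i. i \<in> A \<Longrightarrow> N (f i) \<le> B" "0 \<le> B"
  shows "N (sum f A) \<le> B"
  using assms
proof (induction A rule: infinite_finite_induct)
  case (insert a A)
  have "N (sum f (insert a A)) \<le> max (N (f a)) (N (sum f A))"
    using insert.hyps by (simp add: N_add_le)
  also have "\<dots> \<le> B"
    using insert by simp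
  finally show ?case .
qed simp_all

lemma N_sum_less:
  assumes "\<And>i. i \<in> A \<Longrightarrow> N (f i) < B" "0 < B"
  shows "N (sum f A) < B"
  using assms
proof (induction A rule: infinite_finite_induct)
  case (insert a A)
  have "N (sum f (insert a A)) \<le> max (N (f a)) (N (sum f A))"
    using insert.hyps by (simp add: N_add_le)
  also have "\<dots> < B"
    using insert by simp
  finally show ?case .
qed simp_all

lemma N_add_eq:
  assumes "N y < N x"
  shows "N (x + y) = N x"
proof (rule antisym)
  show "N (x + y) \<le> N x"
    using N_add_le[of x y] assms by simp
  have "N x \<le> max (N (x + y)) (N y)"
    using N_diff_le[of "x + y" y] by simp
  then show "N x \<le> N (x + y)"
    using assms by simp
qed

section \<open>The Gauss norm of a polynomial\<close>

definition gnorm :: "'l poly \<Rightarrow> real" where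
  "gnorm f = Max ((\<lambda>i. N (coeff f i)) ` {..degree f})"

lemma N_coeff_le_gnorm: "N (coeff f i) \<le> gnorm f"
proof (cases "i \<le> degree f")
  case True
  then show ?thesis
    unfolding gnorm_def by (intro Max_ge) auto
next
  case False
  then have "N (coeff f i) \<le> N (coeff f 0)"
    by (simp add: coeff_eq_0 N_nonneg)
  also have "\<dots> \<le> gnorm f"
    unfolding gnorm_def by (intro Max_ge) auto
  finally show ?thesis .
qed

lemma gnorm_attained: "\<exists>i. N (coeff f i) = gnorm f"
proof -
  have "gnorm f \<in> (\<lambda>i. N (coeff f i)) ` {..degree f}"
    unfolding gnorm_def by (intro Max_in) auto
  then show ?thesis
    by auto
qed

lemma gnorm_leI: "(\<And>i. N (coeff f i) \<le> B) \<Longrightarrow> gnorm f \<le> B"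
  using gnorm_attained[of f] by metis

lemma gnorm_nonneg: "0 \<le> gnorm f"
  using N_coeff_le_gnorm[of f 0] N_nonneg[of "coeff f 0"] by linarith

lemma gnorm_0 [simp]: "gnorm 0 = 0"
  using gnorm_attained[of 0] by simp

lemma gnorm_pos: "f \<noteq> 0 \<Longrightarrow> 0 < gnorm f"
  using N_coeff_le_gnorm[of f "degree f"] N_pos[of "lead_coeff f"] by force

text \<open>Gauss's lemma. If a and b are the least indices at which the two norms are attained, the
  coefficient of the product at a + b has a single dominant term: in every other term one factor has
  an index below a or below b.\<close>

lemma gnorm_mult: "gnorm (f * g) = gnorm f * gnorm g"
proof (cases "f = 0 \<or> g = 0")
  case False
  then have pos: "0 < gnorm f" "0 < gnorm g"
    by (auto intro: gnorm_pos)
  show ?thesis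
  proof (rule antisym)
    show "gnorm (f * g) \<le> gnorm f * gnorm g"
      by (intro gnorm_leI)
        (auto simp: coeff_mult N_mult intro!: N_sum_le mult_mono N_coeff_le_gnorm N_nonneg gnorm_nonneg
          mult_nonneg_nonneg)
    define a where "a = (LEAST i. N (coeff f i) = gnorm f)"
    define b where "b = (LEAST i. N (coeff g i) = gnorm g)"
    have a: "N (coeff f a) = gnorm f"
      unfolding a_def by (rule LeastI_ex[OF gnorm_attained])
    have b: "N (coeff g b) = gnorm g"
      unfolding b_def by (rule LeastI_ex[OF gnorm_attained])
    have below_a: "N (coeff f i) < gnorm f" if "i < a" for i
      using not_less_Least[OF that[unfolded a_def]] N_coeff_le_gnorm[of f i] by simp
    have below_b: "N (coeff g i) < gnorm g" if "i < b" for i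
      using not_less_Least[OF that[unfolded b_def]] N_coeff_le_gnorm[of g i] by simp
    let ?t = "\<lambda>i. coeff f i * coeff g (a + b - i)"
    have "N (sum ?t ({..a + b} - {a})) < gnorm f * gnorm g"
    proof (rule N_sum_less)
      fix i
      assume i: "i \<in> {..a + b} - {a}"
      show "N (?t i) < gnorm f * gnorm g"
      proof (cases "i < a")
        case True
        then show ?thesis
          unfolding N_mult
          by (meson below_a[OF True] pos N_coeff_le_gnorm N_nonneg mult_left_mono
              mult_strict_right_mono order_le_less_trans)
      next
        case False
        then have "N (coeff g (a + b - i)) < gnorm g"
          using i by (intro below_b) auto
        then show ?thesis
          unfolding N_mult
          by (meson pos N_coeff_le_gnorm N_nonneg less_le_trans mult_le_less_imp_less mult_left_mono
              mult_right_mono mult_strict_left_mono order_le_less_trans)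
      qed
    qed (use pos in simp)
    moreover have "coeff (f * g) (a + b) = ?t a + sum ?t ({..a + b} - {a})"
      by (simp add: coeff_mult sum.remove[of _ a])
    ultimately have "N (coeff (f * g) (a + b)) = gnorm f * gnorm g"
      using N_add_eq[of "sum ?t ({..a + b} - {a})" "?t a"] by (simp add: N_mult a b)
    then show "gnorm f * gnorm g \<le> gnorm (f * g)"
      using N_coeff_le_gnorm[of "f * g" "a + b"] by simp
  qed
qed auto

lemma gnorm_linear: "gnorm [:- c, 1:] = max 1 (N c)"
  by (simp add: gnorm_def atMost_Suc max.commute)

lemma gnorm_smult: "gnorm (smult c f) = N c * gnorm f"
proof -
  have "gnorm [:c:] = N c"
    by (simp add: gnorm_def)
  then show ?thesis
    using gnorm_mult[of "[:c:]" f] by simp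
qed

lemma gnorm_le_mult_linear: "gnorm f \<le> gnorm ([:- c, 1:] * f)"
  unfolding gnorm_mult gnorm_linear using gnorm_nonneg[of f] by (simp add: mult_le_cancel_right1)

text \<open>The integer factors brought in by differentiation have norm at most 1 by the ultrametric
  inequality.\<close>

lemma gnorm_pderiv_le: "gnorm (pderiv f) \<le> gnorm f"
proof (rule gnorm_leI)
  have nat_le: "N (of_nat m) \<le> 1" for m
  proof (induction m)
    case (Suc m)
    then show ?case
      using N_add_le[of 1 "of_nat m"] by simp
  qed simp
  fix i
  have "N (coeff (pderiv f) i) \<le> 1 * N (coeff f (Suc i))"
    unfolding coeff_pderiv N_mult using nat_le[of "Suc i"] by (intro mult_right_mono N_nonneg) simp
  then show "N (coeff (pderiv f) i) \<le> gnorm f"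
    using N_coeff_le_gnorm[of f "Suc i"] by simp
qed

lemma N_poly_le:
  assumes "degree f \<le> m"
  shows "N (poly f x) \<le> gnorm f * max 1 (N x) ^ m"
  unfolding poly_altdef
proof (rule N_sum_le)
  fix i
  assume i: "i \<in> {..degree f}"
  have "N x ^ i \<le> max 1 (N x) ^ i"
    by (intro power_mono) (auto simp: N_nonneg)
  also have "\<dots> \<le> max 1 (N x) ^ m"
    using i assms by (intro power_increasing) auto
  finally show "N (coeff f i * x ^ i) \<le> gnorm f * max 1 (N x) ^ m"
    unfolding N_mult N_power by (intro mult_mono N_coeff_le_gnorm gnorm_nonneg) (auto simp: N_nonneg)
qed (auto intro!: mult_nonneg_nonneg gnorm_nonneg)

end

subsection \<open>Splitting polynomials\<close>

text \<open>Estimates that behave well under products can thus be proved one root at a time.\<close>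

lemma poly_split_induct [case_names const linear]:
  fixes f :: "'l::alg_closed_field poly"
  assumes const: "\<And>c. P [:c:]"
    and linear: "\<And>a g. P g \<Longrightarrow> P ([:- a, 1:] * g)"
  shows "P f"
proof (induction "degree f" arbitrary: f)
  case 0
  then show ?case
    using const by (metis degree_eq_zeroE)
next
  case (Suc d)
  then obtain a where "poly f a = 0"
    using alg_closed_imp_poly_has_root[of f] by auto
  then obtain g where g: "f = [:- a, 1:] * g"
    by (meson dvdE poly_eq_0_iff_dvd)
  then have "g \<noteq> 0"
    using Suc.hyps(2) by auto
  then have "degree f = Suc (degree g)"
    unfolding g by (subst degree_mult_eq) auto
  then show ?case
    using Suc g linear by simp
qed

lemma poly_linear_mult: "poly ([:- a, 1:] * g) x = (x - a) * poly g x" for a :: "'a::comm_ring_1"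
  by (simp add: algebra_simps)

locale ultrametric_norm_alg_closed = ultrametric_norm N
  for N :: "'l::alg_closed_field \<Rightarrow> real"
begin

lemma N_diff_eq_of_far: "N (x - y) \<le> d \<Longrightarrow> d < N (x - c) \<Longrightarrow> N (y - c) = N (x - c)"
  using N_add_eq[of "y - x" "x - c"] N_minus_commute[of x y] by simp

text \<open>In each linear factor, replacing x by the nearer point y leaves the norm unchanged, as
  an ultrametric triangle is isosceles.\<close>

lemma N_poly_eq_of_far_roots:
  assumes "\<And>c. poly f c = 0 \<Longrightarrow> d < N (x - c)" "N (x - y) \<le> d"
  shows "N (poly f y) = N (poly f x)"
  using assms(1)
proof (induction f rule: poly_split_induct)
  case (linear a g)
  have "N (y - a) = N (x - a)"
    using linear.prems[of a] assms(2) by (intro N_diff_eq_of_far) auto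
  moreover have "N (poly g y) = N (poly g x)"
    using linear.prems by (intro linear.IH) auto
  ultimately show ?case
    by (simp add: N_mult poly_linear_mult del: mult_pCons_left)
qed simp

text \<open>The logarithmic derivative is the sum of the \<open>1 / (x - c)\<close> over the roots \<open>c\<close>.\<close>

lemma N_pderiv_le_of_far_roots:
  assumes "\<And>c. poly f c = 0 \<Longrightarrow> r \<le> N (x - c)" "0 \<le> r"
  shows "N (poly (pderiv f) x) * r \<le> N (poly f x)"
  using assms(1)
proof (induction f rule: poly_split_induct)
  case (const c)
  then show ?case
    by (simp add: pderiv_pCons N_nonneg)
next
  case (linear a g)
  have IH: "N (poly (pderiv g) x) * r \<le> N (poly g x)"
    using linear.prems by (intro linear.IH) auto
  have a: "r \<le> N (x - a)"
    using linear.prems by simp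
  have "poly (pderiv ([:- a, 1:] * g)) x = poly g x + (x - a) * poly (pderiv g) x"
    unfolding pderiv_mult by (simp add: pderiv_pCons algebra_simps del: mult_pCons_left)
  then have "N (poly (pderiv ([:- a, 1:] * g)) x) * r
      \<le> max (N (poly g x)) (N (x - a) * N (poly (pderiv g) x)) * r"
    using N_add_le[of "poly g x" "(x - a) * poly (pderiv g) x"] assms(2)
    by (intro mult_right_mono) (simp_all only: N_mult)
  also have "\<dots> \<le> N (x - a) * N (poly g x)"
  proof -
    have "N (poly g x) * r \<le> N (x - a) * N (poly g x)"
      using a by (subst mult.commute) (intro mult_right_mono N_nonneg)
    moreover have "N (x - a) * N (poly (pderiv g) x) * r \<le> N (x - a) * N (poly g x)"
      using mult_left_mono[OF IH N_nonneg[of "x - a"]] by (simp add: mult.assoc)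
    ultimately show ?thesis
      by (simp add: max_def)
  qed
  finally show ?case
    by (simp add: N_mult poly_linear_mult del: mult_pCons_left)
qed

end

subsection \<open>The resultant as a product over roots\<close>

text \<open>Squared, so that the sign need not be tracked.\<close>

lemma resultant_square_step:
  fixes f g :: "'l::field poly"
  assumes "degree f \<le> degree g" "0 < degree f"
  shows "(resultant f g)\<^sup>2 =
    (if degree (g mod f) = 0 then lead_coeff f ^ degree g * coeff (g mod f) 0 ^ degree f
     else lead_coeff f ^ (degree g - degree (g mod f)) * resultant f (g mod f))\<^sup>2"
proof -
  define h where "h = g mod f"
  have "f \<noteq> 0"
    using assms by auto
  \<comment> \<open>Division with remainder in the form used by the subresultant lemmas; a constant
    remainder, zero included, is treated separately from one of positive degree.\<close>
  have eq: "g + (- (g div f)) * f = h"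
    by (simp add: h_def minus_div_mult_eq_mod [symmetric])
  have less: "degree h < degree f"
    unfolding h_def using assms \<open>f \<noteq> 0\<close> by (metis degree_0 degree_mod_less)
  then have choice: "degree h < degree f \<or> h = 0 \<and> g \<noteq> 0 \<and> f \<noteq> 0"
    by simp
  have swap: "(resultant f g)\<^sup>2 = (resultant g f)\<^sup>2"
    unfolding resultant_swap[of f g] by (simp add: power_mult_distrib flip: power_mult)
  show ?thesis
  proof (cases "degree h = 0")
    case True
    then obtain c where c: "h = [:c:]"
      by (metis degree_eq_zeroE)
    have "resultant g f = coeff (subresultant 0 g f) 0"
      by (simp add: coeff_subresultant_0_0_resultant)
    also have "subresultant 0 g f = smult ((-1) ^ (degree g * degree f) * lead_coeff f ^ degree g * c ^ (degree f - 1)) [:c:]"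
      using BT_lemma_1_13[OF eq assms(1) choice] less True by (simp add: c)
    also have "coeff \<dots> 0 = (-1) ^ (degree g * degree f) * lead_coeff f ^ degree g * c ^ degree f"
      using assms(2) by (cases "degree f") simp_all
    finally show ?thesis
      unfolding swap using True by (simp add: power_mult_distrib c flip: power_mult h_def)
  next
    case False
    have "resultant g f = coeff (subresultant 0 g f) 0"
      by (simp add: coeff_subresultant_0_0_resultant)
    also have "subresultant 0 g f = smult ((-1) ^ (degree g * degree f) * lead_coeff f ^ (degree g - degree h)) (subresultant 0 f h)"
      using BT_lemma_1_12[OF eq assms(1) choice, of 0] False by simp
    also have "coeff \<dots> 0 = (-1) ^ (degree g * degree f) * lead_coeff f ^ (degree g - degree h) * resultant f h"
      by (simp add: coeff_subresultant_0_0_resultant)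
    finally show ?thesis
      unfolding swap using False by (simp add: power_mult_distrib flip: power_mult h_def)
  qed
qed

text \<open>A multiset records multiplicities, so repeated roots of inseparable polynomials are
  covered.\<close>

abbreviation (input) split_poly :: "'l::field \<Rightarrow> 'l multiset \<Rightarrow> 'l poly" where
  "split_poly a A \<equiv> smult a (\<Prod>x\<in>#A. [:- x, 1:])"

lemma poly_split_poly: "poly (split_poly a A) y = a * (\<Prod>x\<in>#A. y - x)"
proof -
  have "poly (\<Prod>x\<in>#A. [:- x, 1:]) y = (\<Prod>x\<in>#A. y - x)"
    by (induction A) (simp_all add: poly_linear_mult del: mult_pCons_left)
  then show ?thesis
    by simp
qed

lemma degree_prod_linear: "degree (\<Prod>x\<in>#A. [:- x, 1:]) = size A" for A :: "'l::field multiset"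
  by (induction A) (simp_all add: degree_mult_eq prod_mset_zero_iff image_iff del: mult_pCons_left)

lemma degree_split_poly: "a \<noteq> 0 \<Longrightarrow> degree (split_poly a A) = size A"
  using degree_prod_linear[of A] by simp

lemma lead_coeff_split_poly: "lead_coeff (split_poly a A) = a"
proof -
  have "lead_coeff (\<Prod>x\<in>#A. [:- x, 1:]) = 1"
    by (induction A) (simp_all add: lead_coeff_mult del: mult_pCons_left)
  then show ?thesis
    by (simp only: lead_coeff_smult mult_1_right)
qed

lemma prod_mset_square: "(prod_mset A)\<^sup>2 = (\<Prod>x\<in>#A. x\<^sup>2)" for A :: "'l::comm_semiring_1 multiset"
  by (induction A) (simp_all add: power_mult_distrib)

lemma prod_mset_smult: "(\<Prod>x\<in>#A. a * f x) = a ^ size A * (\<Prod>x\<in>#A. f x)" for a :: "'l::comm_semiring_1"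
  by (induction A) (simp_all add: algebra_simps)

lemma prod_mset_poly_const: "(\<Prod>x\<in>#A. poly [:c:] x) = c ^ size A"
  by (induction A) simp_all

text \<open>The Euclidean algorithm: passing from g to its remainder modulo f keeps the values at
  the roots of f, and exchanging f and g only reorders the product of differences of roots, up to
  sign.\<close>

lemma square_resultant_split_poly:
  fixes g :: "'l::alg_closed_field poly"
  assumes "a \<noteq> 0"
  shows "(resultant (split_poly a A) g)\<^sup>2 = (a ^ degree g * (\<Prod>x\<in>#A. poly g x))\<^sup>2"
  using assms
\<comment> \<open>A division lowers the doubled sum of degrees by at least 2; an exchange keeps it
  but clears the last summand.\<close>
proof (induction "2 * (size A + degree g) + (if degree g < size A then 1 else 0)" arbitrary: a A g
    rule: less_induct)
  case less
  define f where "f = split_poly a A"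
  have deg: "degree f = size A" and lead: "lead_coeff f = a"
    and poly_f: "poly f y = a * (\<Prod>x\<in>#A. y - x)" for y
    unfolding f_def
    by (rule degree_split_poly[OF less.prems] lead_coeff_split_poly poly_split_poly)+
  consider "A = {#}" | c where "g = [:c:]" "A \<noteq> {#}" | "A \<noteq> {#}" "size A \<le> degree g"
    | "degree g < size A" "0 < degree g"
    by (metis degree_eq_zeroE gr0I not_le)
  then have "(resultant f g)\<^sup>2 = (a ^ degree g * (\<Prod>x\<in>#A. poly g x))\<^sup>2"
  proof cases
    case 1
    then show ?thesis
      by (simp add: f_def resultant_const)
  next
    case 2
    have "resultant f g = c ^ size A"
      unfolding 2 using deg by (subst resultant_const) simp
    moreover have "(\<Prod>x\<in>#A. poly g x) = c ^ size A"
      unfolding 2 by (rule prod_mset_poly_const)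
    ultimately show ?thesis
      by (simp only: 2(1) degree_pCons_0 power_0 mult_1)
  next
    case 3
    define h where "h = g mod f"
    have "0 < size A"
      using 3(1) by (simp add: nonempty_has_size)
    moreover from this have "f \<noteq> 0"
      by (metis deg degree_0 less_irrefl)
    ultimately have less_deg: "degree h < size A"
      unfolding h_def using deg by (metis degree_0 degree_mod_less)
    have "poly h x = poly g x" if "x \<in># A" for x
    proof -
      have "poly f x = 0"
        using that unfolding poly_f by (auto simp: image_iff)
      moreover have "poly g x = poly (g div f * f + h) x"
        unfolding h_def by (simp only: div_mult_mod_eq)
      ultimately show ?thesis
        by (simp only: poly_add poly_mult mult_zero_right add_0)
    qed
    then have roots: "(\<Prod>x\<in>#A. poly h x) = (\<Prod>x\<in>#A. poly g x)"
      by (intro arg_cong[of _ _ prod_mset] image_mset_cong)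
    show ?thesis
    proof (cases "degree h = 0")
      case True
      then obtain c where c: "h = [:c:]"
        by (metis degree_eq_zeroE)
      have "(resultant f g)\<^sup>2 = (a ^ degree g * c ^ size A)\<^sup>2"
        using resultant_square_step[of f g] 3 \<open>0 < size A\<close> deg True
        by (simp add: lead[unfolded deg] c flip: h_def)
      then show ?thesis
        unfolding roots[symmetric] c prod_mset_poly_const .
    next
      case False
      have "(resultant f h)\<^sup>2 = (a ^ degree h * (\<Prod>x\<in>#A. poly h x))\<^sup>2"
        unfolding f_def using less_deg 3 less.prems by (intro less.hyps) auto
      moreover have "(resultant f g)\<^sup>2 = (a ^ (degree g - degree h))\<^sup>2 * (resultant f h)\<^sup>2"
        using resultant_square_step[of f g] 3 \<open>0 < size A\<close> deg False
        by (simp add: lead[unfolded deg] power_mult_distrib flip: h_def)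
      moreover have "a ^ degree g = a ^ (degree g - degree h) * a ^ degree h"
        using less_deg 3 by (simp flip: power_add)
      ultimately show ?thesis
        by (simp add: roots power_mult_distrib)
    qed
  next
    case 4
    then have "g \<noteq> 0"
      by auto
    then obtain B where B: "size B = degree g" "g = split_poly (lead_coeff g) B"
      using alg_closed_imp_factorization by blast
    define b where "b = lead_coeff g"
    have "b \<noteq> 0"
      using \<open>g \<noteq> 0\<close> by (simp add: b_def)
    have g: "g = split_poly b B"
      using B by (simp add: b_def)
    have "(resultant f g)\<^sup>2 = (resultant g f)\<^sup>2"
      unfolding resultant_swap[of f g] by (simp add: power_mult_distrib flip: power_mult)
    also have "\<dots> = (b ^ degree f * (\<Prod>y\<in>#B. poly f y))\<^sup>2"
      unfolding g using 4 deg B \<open>b \<noteq> 0\<close> by (intro less.hyps) auto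
    also have "\<dots> = (b ^ size A)\<^sup>2 * (a ^ size B)\<^sup>2 * (\<Prod>y\<in>#B. \<Prod>x\<in>#A. (y - x)\<^sup>2)"
      unfolding poly_f prod_mset_smult deg
      by (simp add: power_mult_distrib prod_mset_square multiset.map_comp o_def)
    also have "(\<Prod>y\<in>#B. \<Prod>x\<in>#A. (y - x)\<^sup>2) = (\<Prod>x\<in>#A. \<Prod>y\<in>#B. (x - y)\<^sup>2)"
      by (subst prod_mset.swap) (simp add: power2_commute)
    also have "(b ^ size A)\<^sup>2 * (a ^ size B)\<^sup>2 * \<dots> = (a ^ degree g * (\<Prod>x\<in>#A. b * (\<Prod>y\<in>#B. x - y)))\<^sup>2"
      unfolding prod_mset_smult B(1)
      by (simp add: power_mult_distrib prod_mset_square multiset.map_comp o_def)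
    also have "(\<lambda>x. b * (\<Prod>y\<in>#B. x - y)) = poly g"
      by (rule ext) (subst g, rule poly_split_poly[symmetric])
    finally show ?thesis .
  qed
  then show ?case
    unfolding f_def .
qed

subsection \<open>Primitive polynomials\<close>

lemma exists_prime_divisor_field_poly:
  fixes c :: "'a::field poly"
  assumes "0 < degree c"
  shows "\<exists>d. prime_elem d \<and> 0 < degree d \<and> d dvd c"
proof -
  obtain d e where d: "irreducible\<^sub>d d" "c = d * e"
    using irreducible\<^sub>d_factor[OF assms] by auto
  then have "prime_elem d"
    by (intro field_poly_irreducible_imp_prime) simp
  moreover have "0 < degree d"
    using d(1) irreducible\<^sub>dD(1) by blast
  ultimately show ?thesis
    using d(2) by auto
qed

text \<open>Prime factors d of c are cancelled one by one: \<open>[:d:]\<close> is prime and does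
  not divide the primitive P, so it divides A. Once c is constant it is a unit.\<close>

lemma primitive_dvd_of_smult_eq_mult:
  fixes P Q A :: "'a::field poly poly"
  assumes "c \<noteq> 0" "smult c Q = A * P"
    and primitive: "\<And>D. (\<forall>i. D dvd coeff P i) \<Longrightarrow> D dvd 1"
  shows "P dvd Q"
  using assms(1,2)
proof (induction "degree c" arbitrary: c A rule: less_induct)
  case less
  show ?case
  proof (cases "degree c = 0")
    case True
    then obtain u where "c = [:u:]" "u \<noteq> 0"
      using less.prems(1) by (metis degree_eq_zeroE pCons_0_0)
    then have "[:inverse u:] * c = 1"
      by (simp add: pCons_one)
    then have "Q = smult [:inverse u:] (smult c Q)"
      by simp
    also have "\<dots> = smult [:inverse u:] A * P"
      using less.prems(2) by simp
    finally show ?thesis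
      by (metis dvd_triv_right)
  next
    case False
    then obtain d where d: "prime_elem d" "0 < degree d" "d dvd c"
      using exists_prime_divisor_field_poly[of c] by auto
    then obtain e where e: "c = d * e"
      by auto
    have "prime_elem [:d:]"
      using d(1) by (simp add: prime_elem_const_poly_iff)
    moreover have "[:d:] dvd A * P"
      by (simp add: less.prems(2)[symmetric] const_poly_dvd_iff e)
    moreover have "\<not> [:d:] dvd P"
    proof
      assume "[:d:] dvd P"
      then have "d dvd 1"
        by (intro primitive) (simp add: const_poly_dvd_iff)
      then show False
        using d(1) prime_elem_not_unit by blast
    qed
    ultimately have "[:d:] dvd A"
      using prime_elem_dvd_mult_iff by blast
    then obtain B where B: "A = [:d:] * B"
      by auto
    have "d \<noteq> 0" "e \<noteq> 0"
      using less.prems(1) e by auto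
    have "smult d (smult e Q - B * P) = 0"
      using less.prems(2) by (simp add: e B smult_diff_right)
    then have "smult e Q = B * P"
      using \<open>d \<noteq> 0\<close> by (simp del: smult_diff_right)
    moreover have "degree e < degree c"
      using d(2) \<open>d \<noteq> 0\<close> \<open>e \<noteq> 0\<close> by (simp add: e degree_mult_eq)
    ultimately show ?thesis
      using less.hyps \<open>e \<noteq> 0\<close> by blast
  qed
qed

lemma finite_polys_of_finite_coeffs:
  assumes "finite S"
  shows "finite {P :: 'b::zero poly. degree P \<le> n \<and> (\<forall>i. coeff P i \<in> S)}"
proof (rule finite_subset)
  show "{P. degree P \<le> n \<and> (\<forall>i. coeff P i \<in> S)} \<subseteq> Poly ` {xs. set xs \<subseteq> S \<and> length xs \<le> Suc n}"
  proof
    fix P :: "'b poly"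
    assume P: "P \<in> {P. degree P \<le> n \<and> (\<forall>i. coeff P i \<in> S)}"
    have "set (coeffs P) \<subseteq> S"
      using P by (auto simp: coeffs_def)
    moreover have "length (coeffs P) \<le> Suc n"
      using P by (cases "P = 0") (auto simp: length_coeffs_degree)
    ultimately show "P \<in> Poly ` {xs. set xs \<subseteq> S \<and> length xs \<le> Suc n}"
      by (metis (mono_tags, lifting) Poly_coeffs image_eqI mem_Collect_eq)
  qed
  show "finite (Poly ` {xs. set xs \<subseteq> S \<and> length xs \<le> Suc n})"
    using finite_lists_length_le[OF assms] by simp
qed

subsection \<open>Extensions of the field of Laurent series\<close>

lemma poly_to_fls_0 [simp]: "poly_to_fls 0 = 0"
  by (simp add: poly_to_fls_def)

lemma poly_to_fls_eq_0_iff [simp]: "poly_to_fls R = 0 \<longleftrightarrow> R = 0"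
proof
  assume R: "poly_to_fls R = 0"
  show "R = 0"
  proof (rule poly_eqI)
    fix i
    show "coeff R i = coeff 0 i"
      using arg_cong[OF R, of "\<lambda>f. fls_nth f (- int i)"] by (simp add: nth_poly_to_fls)
  qed
qed simp

lemma comm_ring_hom_poly_to_fls: "comm_ring_hom (poly_to_fls :: 'a::field poly \<Rightarrow> 'a fls)"
proof -
  interpret const: comm_ring_hom "fls_const :: 'a \<Rightarrow> 'a fls"
    by unfold_locales (simp_all add: fls_plus_const fls_const_mult_const)
  interpret const_poly: map_poly_comm_ring_hom "fls_const :: 'a \<Rightarrow> 'a fls" ..
  show ?thesis
    by unfold_locales (simp_all add: poly_to_fls_def const_poly.hom_add const_poly.hom_mult)
qed

lemma one_less_card_field: "1 < real CARD('a::{field,finite})"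
proof -
  have "card {0, 1 :: 'a} \<le> CARD('a)"
    by (intro card_mono) auto
  then show ?thesis
    by simp
qed

text \<open>Turns smallness into vanishing of coefficients, the form needed both for completeness
  and for the pigeonhole count.\<close>

lemma fls_abs_le_iff:
  fixes f :: "'a::{field,finite} fls"
  shows "fls_abs f \<le> real CARD('a) powr (- of_int k) \<longleftrightarrow> (\<forall>i<k. fls_nth f i = 0)"
proof (cases "f = 0")
  case False
  have "fls_abs f \<le> real CARD('a) powr (- of_int k) \<longleftrightarrow> k \<le> fls_subdegree f"
    using False one_less_card_field[where 'a = 'a] by (simp add: fls_abs_def)
  also have "\<dots> \<longleftrightarrow> (\<forall>i<k. fls_nth f i = 0)"
    using False fls_subdegree_geI by force
  finally show ?thesis .
qed (simp add: fls_abs_def)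

text \<open>The setting of the main argument. It is later instantiated with the algebraic closure
  and the norm pulled back from the completion, since every algebraic approximation already lies
  there.\<close>

locale laurent_extension = ultrametric_norm_alg_closed N
  for N :: "'l::alg_closed_field \<Rightarrow> real" +
  fixes j :: "'a::{field,finite} fls \<Rightarrow> 'l"
  assumes j_add: "j (x + y) = j x + j y"
    and j_mult: "j (x * y) = j x * j y"
    and j_one: "j 1 = 1"
    and N_j: "N (j x) = fls_abs x"
begin

sublocale j: field_hom j
proof
  show "j 0 = 0"
    using j_add[of 0 0] add_cancel_left_left[of "j 0" "j 0"] by simp
qed (simp_all add: j_add j_mult j_one)

definition q :: real where
  "q = real CARD('a)"

lemma q_gt_1: "1 < q"
  using one_less_card_field[where 'a = 'a] by (simp add: q_def)

definition emb :: "'a poly \<Rightarrow> 'l" where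
  "emb R = j (poly_to_fls R)"

sublocale emb: inj_comm_ring_hom emb
proof -
  interpret p: comm_ring_hom "poly_to_fls :: 'a poly \<Rightarrow> 'a fls"
    by (rule comm_ring_hom_poly_to_fls)
  show "inj_comm_ring_hom emb"
    by unfold_locales (simp_all add: emb_def p.hom_add p.hom_mult j.hom_add j.hom_mult)
qed

sublocale emb_poly: map_poly_inj_comm_ring_hom emb ..

lemma N_emb: "R \<noteq> 0 \<Longrightarrow> N (emb R) = q ^ degree R"
  by (simp add: emb_def N_j fls_abs_poly_to_fls q_def)

lemma N_emb_ge_1: "R \<noteq> 0 \<Longrightarrow> 1 \<le> N (emb R)"
  using q_gt_1 by (simp add: N_emb)

lemma N_emb_le: "R = 0 \<or> degree R \<le> k \<Longrightarrow> N (emb R) \<le> q ^ k"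
  using q_gt_1 by (cases "R = 0") (auto simp: N_emb intro: power_increasing)

abbreviation map_emb :: "'a poly poly \<Rightarrow> 'l poly" where
  "map_emb \<equiv> map_poly emb"

lemma eval_at_emb: "eval_at emb P x = poly (map_emb P) x"
  by (simp add: eval_at_def)

lemma height_eq_gnorm: "height P = gnorm (map_emb P)"
  unfolding height_def gnorm_def by (simp add: emb_def N_j)

lemma height_mult: "height (P * Q) = height P * height Q"
  for P Q :: "'a poly poly"
  by (simp add: height_eq_gnorm gnorm_mult emb_poly.hom_mult)

lemma height_attained: "\<exists>i. height P = N (emb (coeff P i))"
  using gnorm_attained[of "map_emb P"] by (metis height_eq_gnorm emb.coeff_map_poly_hom)

lemma N_emb_coeff_le_height: "N (emb (coeff P i)) \<le> height P"
  using N_coeff_le_gnorm[of "map_emb P" i] by (simp add: height_eq_gnorm)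

lemma height_pos: "P \<noteq> 0 \<Longrightarrow> 0 < height P" for P :: "'a poly poly"
  by (simp add: height_eq_gnorm gnorm_pos)

lemma height_power: "P \<noteq> 0 \<Longrightarrow> \<exists>h. height P = q ^ h" for P :: "'a poly poly"
proof -
  assume "P \<noteq> 0"
  obtain i where i: "height P = N (emb (coeff P i))"
    using height_attained by blast
  then have "coeff P i \<noteq> 0"
    using height_pos[OF \<open>P \<noteq> 0\<close>] by auto
  then show ?thesis
    using i N_emb by auto
qed

lemma height_ge_1: "P \<noteq> 0 \<Longrightarrow> 1 \<le> height P" for P :: "'a poly poly"
  using height_power[of P] q_gt_1 by auto

lemma height_leI: "(\<And>i. coeff P i = 0 \<or> degree (coeff P i) \<le> k) \<Longrightarrow> height P \<le> q ^ k"
  for P :: "'a poly poly"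
  using height_attained[of P] N_emb_le by auto

subsection \<open>Minimal polynomials\<close>

text \<open>Primitivity is kept apart, so that the condition survives dividing out a common factor
  of the coefficients, as in \<open>exists_is_min_poly\<close>.\<close>

definition min_deg_poly :: "'l \<Rightarrow> 'a poly poly \<Rightarrow> bool" where
  "min_deg_poly x P \<longleftrightarrow> P \<noteq> 0 \<and> poly (map_emb P) x = 0 \<and>
     (\<forall>Q. Q \<noteq> 0 \<longrightarrow> poly (map_emb Q) x = 0 \<longrightarrow> degree P \<le> degree Q)"

lemma min_deg_polyD:
  assumes "min_deg_poly x P"
  shows "P \<noteq> 0" "poly (map_emb P) x = 0"
    "Q \<noteq> 0 \<Longrightarrow> poly (map_emb Q) x = 0 \<Longrightarrow> degree P \<le> degree Q"
  using assms by (auto simp: min_deg_poly_def)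

lemma exists_min_deg_poly:
  assumes "algebraic_via emb x"
  shows "\<exists>P. min_deg_poly x P"
proof -
  obtain Q where "Q \<noteq> 0 \<and> poly (map_emb Q) x = 0"
    using assms by (auto simp: algebraic_via_def eval_at_emb)
  from ex_has_least_nat[of "\<lambda>P. P \<noteq> 0 \<and> poly (map_emb P) x = 0", OF this, of degree]
  show ?thesis
    unfolding min_deg_poly_def by blast
qed

lemma is_min_poly_iff:
  "is_min_poly emb x P \<longleftrightarrow> min_deg_poly x P \<and> (\<forall>D. (\<forall>i. D dvd coeff P i) \<longrightarrow> D dvd 1)"
  by (auto simp: is_min_poly_def min_deg_poly_def eval_at_emb)

text \<open>Among the polynomials of least degree, take one whose leading coefficient has least
  degree in T. Dividing out a common factor of positive degree would lower that degree.\<close>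

lemma exists_is_min_poly:
  assumes "algebraic_via emb x"
  shows "\<exists>P. is_min_poly emb x P"
proof -
  obtain Q where "min_deg_poly x Q"
    using exists_min_deg_poly[OF assms] by blast
  from ex_has_least_nat[of "min_deg_poly x", OF this, of "\<lambda>P. degree (lead_coeff P)"]
  obtain P where P: "min_deg_poly x P"
    and least: "\<And>Q. min_deg_poly x Q \<Longrightarrow> degree (lead_coeff P) \<le> degree (lead_coeff Q)"
    by blast
  have "D dvd 1" if D: "\<forall>i. D dvd coeff P i" for D
  proof -
    obtain R where R: "P = smult D R"
      using D const_poly_dvd_iff[of D P] by (auto elim: dvdE)
    then have nz: "D \<noteq> 0" "R \<noteq> 0"
      using min_deg_polyD(1)[OF P] by auto
    have "min_deg_poly x R"
      using P nz unfolding min_deg_poly_def R by (simp add: emb.map_poly_hom_smult)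
    then have "degree D = 0"
      using least[of R] nz by (simp add: R degree_mult_eq)
    then show ?thesis
      using nz by (auto elim!: degree_eq_zeroE simp: const_poly_dvd_iff dvd_field_iff)
  qed
  then show ?thesis
    using P is_min_poly_iff by blast
qed

lemma is_min_poly_min_poly: "algebraic_via emb x \<Longrightarrow> is_min_poly emb x (min_poly emb x)"
  unfolding min_poly_def by (rule someI_ex) (rule exists_is_min_poly)

lemma min_deg_poly_min_poly: "algebraic_via emb x \<Longrightarrow> min_deg_poly x (min_poly emb x)"
  using is_min_poly_min_poly is_min_poly_iff by blast

text \<open>The pseudo-remainder vanishes at x and has degree below that of P, hence is
  zero.\<close>

lemma min_deg_poly_pseudo_division:
  assumes P: "min_deg_poly x P" and Q: "poly (map_emb Q) x = 0"
  shows "\<exists>c A. c \<noteq> 0 \<and> smult c Q = A * P"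
proof -
  obtain A R where AR: "pseudo_divmod Q P = (A, R)"
    by force
  define c where "c = lead_coeff P ^ (Suc (degree Q) - degree P)"
  have "P \<noteq> 0"
    using P by (rule min_deg_polyD)
  then have eq: "smult c Q = P * A + R" and R: "R = 0 \<or> degree R < degree P"
    using pseudo_divmod[OF _ AR] by (auto simp: c_def)
  have "poly (map_emb R) x = 0"
    using arg_cong[OF eq, of "\<lambda>f. poly (map_emb f) x"] Q min_deg_polyD(2)[OF P]
    by (simp add: emb_poly.hom_mult emb_poly.hom_add emb.map_poly_hom_smult)
  then have "R = 0"
    using R min_deg_polyD(3)[OF P, of R] by linarith
  then show ?thesis
    using eq \<open>P \<noteq> 0\<close> by (intro exI[of _ c] exI[of _ A]) (simp add: c_def mult.commute)
qed

lemma min_poly_dvd: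
  assumes "algebraic_via emb x" "poly (map_emb Q) x = 0"
  shows "min_poly emb x dvd Q"
proof -
  have P: "is_min_poly emb x (min_poly emb x)"
    using assms(1) by (rule is_min_poly_min_poly)
  then obtain c A where "c \<noteq> 0" "smult c Q = A * min_poly emb x"
    using min_deg_poly_pseudo_division[OF _ assms(2)] is_min_poly_iff by blast
  then show ?thesis
    using P primitive_dvd_of_smult_eq_mult is_min_poly_iff by blast
qed

lemma root_algebraic: "Q \<noteq> 0 \<Longrightarrow> poly (map_emb Q) x = 0 \<Longrightarrow> algebraic_via emb x"
  by (auto simp: algebraic_via_def eval_at_emb)

text \<open>The minimal polynomial divides Q, heights are multiplicative, and the cofactor has
  height at least 1.\<close>

lemma alg_height_le:
  assumes "Q \<noteq> 0" "poly (map_emb Q) x = 0"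
  shows "alg_height emb x \<le> height Q"
proof -
  obtain A where A: "Q = min_poly emb x * A"
    using min_poly_dvd[OF root_algebraic[OF assms] assms(2)] unfolding dvd_def by blast
  then have "A \<noteq> 0" "min_poly emb x \<noteq> 0"
    using assms(1) by auto
  then have "height (min_poly emb x) * 1 \<le> height (min_poly emb x) * height A"
    by (intro mult_left_mono height_ge_1) (simp_all add: height_pos less_imp_le)
  then show ?thesis
    by (simp add: A height_mult alg_height_def)
qed

lemma alg_degree_le:
  assumes "Q \<noteq> 0" "poly (map_emb Q) x = 0"
  shows "alg_degree emb x \<le> degree Q"
  unfolding alg_degree_def
  by (rule min_deg_polyD(3)[OF min_deg_poly_min_poly[OF root_algebraic[OF assms]] assms])

lemma alg_height_ge_1: "algebraic_via emb x \<Longrightarrow> 1 \<le> alg_height emb x"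
  unfolding alg_height_def by (rule height_ge_1[OF min_deg_polyD(1)[OF min_deg_poly_min_poly]])

text \<open>Northcott's property: over a finite field there are finitely many candidate minimal
  polynomials, each with finitely many roots.\<close>

lemma finite_bounded_degree_height:
  "finite {x. algebraic_via emb x \<and> alg_degree emb x \<le> n \<and> alg_height emb x \<le> B}"
proof -
  obtain k where k: "B < q ^ k"
    using real_arch_pow[OF q_gt_1, of B] ..
  let ?S = "{R. degree R \<le> k \<and> (\<forall>i. coeff R i \<in> (UNIV :: 'a set))}"
  let ?P = "{P. degree P \<le> n \<and> (\<forall>i. coeff P i \<in> ?S)}"
  have "{x. algebraic_via emb x \<and> alg_degree emb x \<le> n \<and> alg_height emb x \<le> B}
      \<subseteq> (\<Union>P\<in>?P - {0}. {x. poly (map_emb P) x = 0})"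
  proof
    fix x
    assume x: "x \<in> {x. algebraic_via emb x \<and> alg_degree emb x \<le> n \<and> alg_height emb x \<le> B}"
    let ?M = "min_poly emb x"
    have M: "min_deg_poly x ?M"
      using x min_deg_poly_min_poly by blast
    have "degree (coeff ?M i) \<le> k" for i
    proof (cases "coeff ?M i = 0")
      case False
      then have "q ^ degree (coeff ?M i) \<le> height ?M"
        using N_emb_coeff_le_height[of ?M i] by (simp add: N_emb)
      also have "\<dots> < q ^ k"
        using x k by (simp add: alg_height_def)
      finally show ?thesis
        using q_gt_1 by simp
    qed simp
    then show "x \<in> (\<Union>P\<in>?P - {0}. {x. poly (map_emb P) x = 0})"
      using x min_deg_polyD(1,2)[OF M] by (auto simp: alg_degree_def)
  qed
  moreover have "finite ?P"
    by (intro finite_polys_of_finite_coeffs finite)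
  then have "finite (\<Union>P\<in>?P - {0}. {x. poly (map_emb P) x = 0})"
    by (intro finite_UN_I poly_roots_finite) auto
  ultimately show ?thesis
    by (rule finite_subset)
qed

end

subsection \<open>Completeness and Newton's method\<close>

context laurent_extension
begin

lemma powr_neg_nat: "q powr (- of_int (int k)) = (1 / q) ^ k"
  using q_gt_1 by (simp add: powr_minus powr_realpow power_inverse divide_inverse)

text \<open>The field of Laurent series is complete, hence closed in the extension.\<close>

lemma in_range_of_approximable:
  assumes "\<And>e. 0 < e \<Longrightarrow> \<exists>x. N (j x - b) < e"
  shows "b \<in> range j"
proof -
  have "\<exists>x. N (j x - b) < (1 / q) ^ k" for k
    using q_gt_1 by (intro assms) simp
  then obtain x where x: "N (j (x k) - b) < (1 / q) ^ k" for k
    by metis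
  have agree: "fls_nth (x k) i = fls_nth (x m) i" if "i < int k" "k \<le> m" for i k m
  proof -
    have "(1 / q) ^ m \<le> (1 / q) ^ k"
      using that(2) q_gt_1 by (intro power_decreasing) auto
    then have "N ((j (x k) - b) - (j (x m) - b)) \<le> (1 / q) ^ k"
      using N_diff_le[of "j (x k) - b" "j (x m) - b"] x[of k] x[of m] by linarith
    then have "N (j (x k - x m)) \<le> (1 / q) ^ k"
      by (simp add: j.hom_minus)
    then show ?thesis
      using fls_abs_le_iff[of "x k - x m" "int k"] that(1) powr_neg_nat[of k] by (simp add: N_j q_def)
  qed
  \<comment> \<open>By \<open>agree\<close>, the coefficient at i no longer changes from the
    approximation with index i + 1 on (index 0 if i is negative).\<close>
  define c where "c i = (if i < 0 then fls_nth (x 0) i else fls_nth (x (Suc (nat i))) i)" for i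
  define y where "y = Abs_fls c"
  have "c i = 0" if "i < min 0 (fls_subdegree (x 0))" for i
    using that by (simp add: c_def)
  then have y: "fls_nth y i = c i" for i
    unfolding y_def by (intro nth_Abs_fls_lower_bound[of "min 0 (fls_subdegree (x 0))"]) auto
  have close: "N (j (y - x k)) \<le> (1 / q) ^ k" for k
  proof -
    have "fls_nth (y - x k) i = 0" if "i < int k" for i
      using that agree[of i 0 k] agree[of i "Suc (nat i)" k] by (auto simp: y c_def)
    then show ?thesis
      using fls_abs_le_iff[of "y - x k" "int k"] powr_neg_nat[of k] by (simp add: N_j q_def)
  qed
  have "N (j y - b) < e" if e: "0 < e" for e
  proof -
    obtain k where k: "(1 / q) ^ k < e"
      using real_arch_pow_inv[OF e, of "1 / q"] q_gt_1 by auto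
    have "N (j y - b) \<le> max (N (j (y - x k))) (N (j (x k) - b))"
      using N_add_le[of "j (y - x k)" "j (x k) - b"] by (simp add: j.hom_minus)
    then show ?thesis
      using close[of k] x[of k] k by linarith
  qed
  then have "N (j y - b) = 0"
    using N_nonneg[of "j y - b"] by (metis less_irrefl order_le_less)
  then show ?thesis
    by (auto simp: image_iff)
qed

text \<open>Since the roots of G are at distance at least r, the logarithmic derivative of G near
  \<xi> is at most 1/r. So G dominates the derivative of f, and the Newton correction shrinks the
  distance to b by the factor d/r. The new point is again a Laurent series because f has such
  coefficients.\<close>

lemma newton_step:
  assumes f: "map_poly j f = [:- b, 1:] * G" and "G \<noteq> 0"
    and far: "\<And>c. poly G c = 0 \<Longrightarrow> r \<le> N (j \<xi> - c)"
    and d: "N (j \<xi> - b) \<le> d" "d < r" and x: "N (j x - b) \<le> d"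
  shows "\<exists>y. N (j y - b) \<le> d / r * N (j x - b)"
proof -
  have "0 \<le> d"
    using d(1) N_nonneg[of "j \<xi> - b"] by linarith
  have close: "N (j \<xi> - j x) \<le> d"
    using N_diff_le[of "j \<xi> - b" "j x - b"] d(1) x by simp
  have far_x: "r \<le> N (j x - c)" if "poly G c = 0" for c
    using N_diff_eq_of_far[OF close, of c] far[OF that] d(2) by simp
  have G_nz: "poly G (j x) \<noteq> 0"
    using far_x[of "j x"] d(2) \<open>0 \<le> d\<close> by auto
  have G': "N (poly (pderiv G) (j x)) * r \<le> N (poly G (j x))"
    using far_x d(2) \<open>0 \<le> d\<close> by (intro N_pderiv_le_of_far_roots) auto
  define F' where "F' = poly (map_poly j (pderiv f)) (j x)"
  have F': "F' = poly G (j x) + (j x - b) * poly (pderiv G) (j x)"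
    unfolding F'_def j.map_poly_pderiv f pderiv_mult
    by (simp add: pderiv_pCons algebra_simps del: mult_pCons_left)
  have "N ((j x - b) * poly (pderiv G) (j x)) * r \<le> d * N (poly G (j x))"
    unfolding N_mult mult.assoc using x G' \<open>0 \<le> d\<close> d(2) by (intro mult_mono) (auto simp: N_nonneg)
  also have "\<dots> < N (poly G (j x)) * r"
    using d(2) N_pos[OF G_nz] by simp
  finally have "N ((j x - b) * poly (pderiv G) (j x)) < N (poly G (j x))"
    using d(2) \<open>0 \<le> d\<close> by simp
  then have NF': "N F' = N (poly G (j x))"
    unfolding F' by (rule N_add_eq)
  then have F'_nz: "F' \<noteq> 0"
    using G_nz by (metis N_eq_0_iff)
  define y where "y = x - poly f x / poly (pderiv f) x"
  have "j (poly f x) = (j x - b) * poly G (j x)"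
    using arg_cong[OF f, of "\<lambda>p. poly p (j x)"] by (simp add: poly_linear_mult del: mult_pCons_left)
  moreover have "j (poly (pderiv f) x) = F'"
    by (simp add: F'_def)
  ultimately have "j y - b = (j x - b) - (j x - b) * poly G (j x) / F'"
    by (simp add: y_def j.hom_minus j.hom_div)
  also have "\<dots> = (j x - b) * (F' - poly G (j x)) / F'"
    using F'_nz by (simp add: field_simps)
  also have "\<dots> = (j x - b) * ((j x - b) * poly (pderiv G) (j x)) / F'"
    by (simp add: F')
  finally have "N (j y - b) * (N F' * r) = N (j x - b) * (N (j x - b) * (N (poly (pderiv G) (j x)) * r))"
    using F'_nz by (simp add: N_divide N_mult)
  also have "\<dots> \<le> N (j x - b) * (d * N F')"
    unfolding NF' using x G' \<open>0 \<le> d\<close> d(2) by (intro mult_left_mono mult_mono) (auto simp: N_nonneg)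
  finally have "N (j y - b) * r * N F' \<le> d * N (j x - b) * N F'"
    by (simp add: mult_ac)
  then have "N (j y - b) * r \<le> d * N (j x - b)"
    using N_pos[OF F'_nz] by simp
  then have "N (j y - b) \<le> d / r * N (j x - b)"
    using d(2) \<open>0 \<le> d\<close> by (simp add: field_simps)
  then show ?thesis ..
qed

text \<open>If all other roots were farther from \<xi> than b, Newton's iteration started at \<xi>
  would converge to b, and completeness would put b into the base field.\<close>

lemma second_root_of_irrational_root:
  assumes "f \<noteq> 0" and b: "poly (map_poly j f) b = 0" "b \<notin> range j"
  shows "\<exists>c G. map_poly j f = [:- b, 1:] * ([:- c, 1:] * G) \<and> N (j \<xi> - c) \<le> N (j \<xi> - b)"
proof (rule ccontr)
  assume contra: "\<not> ?thesis"
  define d where "d = N (j \<xi> - b)"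
  obtain G where G: "map_poly j f = [:- b, 1:] * G"
    using b(1) by (meson dvdE poly_eq_0_iff_dvd)
  have "G \<noteq> 0"
    using G \<open>f \<noteq> 0\<close> by auto
  have far: "d < N (j \<xi> - c)" if c: "poly G c = 0" for c
  proof -
    obtain G2 where "G = [:- c, 1:] * G2"
      using c by (meson dvdE poly_eq_0_iff_dvd)
    then show ?thesis
      using contra G unfolding d_def by (metis not_le)
  qed
  \<comment> \<open>The least distance from \<xi> to a remaining root; the extra element d + 1 keeps
    the set nonempty.\<close>
  define r where "r = Min (insert (d + 1) ((\<lambda>c. N (j \<xi> - c)) ` {c. poly G c = 0}))"
  have fin: "finite (insert (d + 1) ((\<lambda>c. N (j \<xi> - c)) ` {c. poly G c = 0}))"
    using poly_roots_finite[OF \<open>G \<noteq> 0\<close>] by simp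
  have "d < r"
    unfolding r_def using fin far by (subst Min_gr_iff) auto
  have far_r: "r \<le> N (j \<xi> - c)" if "poly G c = 0" for c
    unfolding r_def using that fin by (intro Min_le) auto
  have "0 \<le> d"
    by (simp add: d_def N_nonneg)
  have le_1: "(d / r) ^ k \<le> 1" for k
    using \<open>0 \<le> d\<close> \<open>d < r\<close> by (intro power_le_one) auto
  have iterate: "\<exists>x. N (j x - b) \<le> (d / r) ^ k * d" for k
  proof (induction k)
    case 0
    then show ?case
      by (auto simp: d_def)
  next
    case (Suc k)
    then obtain x where x: "N (j x - b) \<le> (d / r) ^ k * d"
      by blast
    also have "\<dots> \<le> 1 * d"
      using le_1 \<open>0 \<le> d\<close> by (intro mult_right_mono)
    finally obtain y where "N (j y - b) \<le> d / r * N (j x - b)"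
      using newton_step[OF G \<open>G \<noteq> 0\<close> far_r _ \<open>d < r\<close>, of x] d_def by auto
    also have "\<dots> \<le> d / r * ((d / r) ^ k * d)"
      using x \<open>0 \<le> d\<close> \<open>d < r\<close> by (intro mult_left_mono) auto
    finally show ?case
      by (auto simp: mult.assoc)
  qed
  have "\<exists>x. N (j x - b) < e" if "0 < e" for e
  proof -
    have "0 < e / (d + 1)"
      using that \<open>0 \<le> d\<close> by simp
    then obtain k where k: "(d / r) ^ k < e / (d + 1)"
      using real_arch_pow_inv[of "e / (d + 1)" "d / r"] \<open>0 \<le> d\<close> \<open>d < r\<close> by auto
    obtain x where "N (j x - b) \<le> (d / r) ^ k * d"
      using iterate by blast
    also have "\<dots> \<le> (d / r) ^ k * (d + 1)"
      using \<open>0 \<le> d\<close> \<open>d < r\<close> by (intro mult_left_mono) auto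
    also have "\<dots> < e"
      using k \<open>0 \<le> d\<close> by (simp add: field_simps)
    finally show ?thesis
      by blast
  qed
  then have "b \<in> range j"
    by (rule in_range_of_approximable)
  then show False
    using b(2) by contradiction
qed

end

subsection \<open>Lower bounds from resultants\<close>

text \<open>The ultrametric analogue of the Mahler measure formula, which lets the height control
  products over part of the roots.\<close>

lemma (in ultrametric_norm) gnorm_split_poly:
  "gnorm (split_poly a A) = N a * (\<Prod>x\<in>#A. max 1 (N x))"
proof -
  have "gnorm (\<Prod>x\<in>#A. [:- x, 1:]) = (\<Prod>x\<in>#A. max 1 (N x))"
  proof (induction A)
    case empty
    then show ?case
      by (simp add: gnorm_def)
  next
    case (add x A)
    then show ?case
      by (simp only: image_mset_add_mset prod_mset.add_mset gnorm_mult gnorm_linear)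
  qed
  then show ?thesis
    by (simp only: gnorm_smult)
qed

lemma (in ultrametric_norm) N_prod_mset: "N (\<Prod>x\<in>#A. f x) = (\<Prod>x\<in>#A. N (f x))"
  by (induction A) (simp_all add: N_mult)

lemma prod_mset_mono_real:
  fixes f g :: "'b \<Rightarrow> real"
  assumes "\<And>x. x \<in># A \<Longrightarrow> 0 \<le> f x \<and> f x \<le> g x"
  shows "0 \<le> (\<Prod>x\<in>#A. f x) \<and> (\<Prod>x\<in>#A. f x) \<le> (\<Prod>x\<in>#A. g x)"
  using assms
proof (induction A)
  case (add x A)
  have "0 \<le> f x \<and> f x \<le> g x"
    by (rule add.prems) simp
  moreover have "0 \<le> (\<Prod>x\<in>#A. f x) \<and> (\<Prod>x\<in>#A. f x) \<le> (\<Prod>x\<in>#A. g x)"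
    by (rule add.IH, rule add.prems) simp
  ultimately show ?case
    by (auto intro: mult_mono)
qed simp

lemma prod_mset_power: "(\<Prod>x\<in>#A. f x ^ n) = (\<Prod>x\<in>#A. f x) ^ n" for f :: "'b \<Rightarrow> real"
  by (induction A) (simp_all add: power_mult_distrib)

context laurent_extension
begin

text \<open>A polynomial of least degree at one of its roots is one at all of them.\<close>

lemma conjugate_root:
  assumes P: "min_deg_poly a P" and x: "poly (map_emb P) x = 0" "poly (map_emb Q) x = 0"
  shows "poly (map_emb Q) a = 0"
proof -
  have "P \<noteq> 0"
    using P by (rule min_deg_polyD)
  then obtain M where M: "min_deg_poly x M"
    using exists_min_deg_poly root_algebraic x(1) by blast
  then obtain c A where c: "c \<noteq> 0" "smult c P = A * M"
    using min_deg_poly_pseudo_division x(1) by blast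
  have "M \<noteq> 0" "A \<noteq> 0"
    using c \<open>P \<noteq> 0\<close> by auto
  then have deg: "degree P = degree A + degree M"
    using c degree_mult_eq[of A M] degree_smult_eq[of c P] by simp
  have "degree M \<noteq> 0"
  proof
    assume "degree M = 0"
    then obtain m where "M = [:m:]"
      by (rule degree_eq_zeroE)
    then show False
      using min_deg_polyD(2)[OF M] \<open>M \<noteq> 0\<close> by simp
  qed
  \<comment> \<open>A has smaller degree than P and so cannot vanish at a. Hence M vanishes there,
    and minimality forces M and P to have the same degree.\<close>
  then have "poly (map_emb A) a \<noteq> 0"
    using min_deg_polyD(3)[OF P \<open>A \<noteq> 0\<close>] deg by auto
  moreover have "poly (map_emb A) a * poly (map_emb M) a = 0"
    using arg_cong[OF c(2), of "\<lambda>f. poly (map_emb f) a"] min_deg_polyD(2)[OF P]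
    by (simp add: emb_poly.hom_mult emb.map_poly_hom_smult)
  ultimately have "poly (map_emb M) a = 0"
    by simp
  then have "degree P \<le> degree M"
    using min_deg_polyD(3)[OF P \<open>M \<noteq> 0\<close>] by simp
  then have "min_deg_poly x P"
    using min_deg_polyD(3)[OF M] \<open>P \<noteq> 0\<close> x(1) unfolding min_deg_poly_def by (meson order_trans)
  then obtain d B where d: "d \<noteq> 0" "smult d Q = B * P"
    using min_deg_poly_pseudo_division x(2) by blast
  have "emb d * poly (map_emb Q) a = 0"
    using arg_cong[OF d(2), of "\<lambda>f. poly (map_emb f) a"] min_deg_polyD(2)[OF P]
    by (simp add: emb_poly.hom_mult emb.map_poly_hom_smult)
  then show ?thesis
    using d(1) by simp
qed

text \<open>The right-hand side is the norm of the resultant, a polynomial in T. It is nonzero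
  because, by \<open>conjugate_root\<close>, Q vanishes at no root of P.\<close>

lemma resultant_ge_1:
  assumes P: "min_deg_poly a P" and Q: "poly (map_emb Q) a \<noteq> 0"
    and split: "map_emb P = split_poly l A"
  shows "1 \<le> N l ^ degree Q * (\<Prod>x\<in>#A. N (poly (map_emb Q) x))"
proof -
  have "l \<noteq> 0"
    using min_deg_polyD(1)[OF P] split by auto
  let ?v = "l ^ degree Q * (\<Prod>x\<in>#A. poly (map_emb Q) x)"
  have res: "(emb (resultant P Q))\<^sup>2 = ?v\<^sup>2"
    using square_resultant_split_poly[OF \<open>l \<noteq> 0\<close>, of A "map_emb Q"]
    unfolding split[symmetric] emb.resultant_hom by simp
  have "poly (map_emb Q) x \<noteq> 0" if "x \<in># A" for x
  proof
    assume "poly (map_emb Q) x = 0"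
    moreover have "poly (map_emb P) x = 0"
      unfolding split poly_split_poly using that by (auto simp: image_iff)
    ultimately show False
      using conjugate_root[OF P] Q by blast
  qed
  then have "?v \<noteq> 0"
    using \<open>l \<noteq> 0\<close> by (auto simp: image_iff)
  then have "resultant P Q \<noteq> 0"
    using res by auto
  then have "1 \<le> (N (emb (resultant P Q)))\<^sup>2"
    using N_emb_ge_1 by simp
  also have "\<dots> = (N ?v)\<^sup>2"
    by (metis N_power res)
  finally have "1 \<le> N ?v"
    using N_nonneg[of ?v] by (metis abs_of_nonneg abs_square_le_1 abs_le_square_iff abs_1 one_power2)
  then show ?thesis
    by (simp add: N_mult N_power N_prod_mset)
qed

text \<open>The roots in A are those near \<xi>, where the value of Q is kept. At the roots in B it
  is bounded trivially, and the resulting factors \<open>max 1 (N x)\<close> are absorbed, with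
  \<open>N l\<close>, into the height of P.\<close>

lemma resultant_bound:
  assumes P: "min_deg_poly a P" and Q: "poly (map_emb Q) a \<noteq> 0"
    and split: "map_emb P = split_poly l (A + B)"
  shows "1 \<le> (\<Prod>x\<in>#A. N (poly (map_emb Q) x)) * height P ^ degree Q * height Q ^ size B"
proof -
  let ?m = "\<lambda>C. (\<Prod>x\<in>#C. max 1 (N x))"
  have ge_1: "1 \<le> ?m C" for C
    using prod_mset_mono_real[of C "\<lambda>_. 1" "\<lambda>x. max 1 (N x)"] by simp
  have hP: "height P = N l * (?m A * ?m B)"
    unfolding height_eq_gnorm split gnorm_split_poly by simp
  have "(\<Prod>x\<in>#B. N (poly (map_emb Q) x)) \<le> (\<Prod>x\<in>#B. height Q * max 1 (N x) ^ degree Q)"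
    using prod_mset_mono_real[of B "\<lambda>x. N (poly (map_emb Q) x)"
        "\<lambda>x. height Q * max 1 (N x) ^ degree Q"] N_poly_le[of "map_emb Q" "degree Q"]
    by (simp add: N_nonneg height_eq_gnorm)
  also have "\<dots> = height Q ^ size B * ?m B ^ degree Q"
    by (simp add: prod_mset_smult prod_mset_power)
  finally have B: "(\<Prod>x\<in>#B. N (poly (map_emb Q) x)) \<le> height Q ^ size B * ?m B ^ degree Q" .
  have nonneg: "0 \<le> (\<Prod>x\<in>#A. N (poly (map_emb Q) x))" "0 \<le> height Q"
    using prod_mset_mono_real[of A "\<lambda>x. N (poly (map_emb Q) x)" "\<lambda>x. N (poly (map_emb Q) x)"]
    by (auto simp: N_nonneg height_eq_gnorm gnorm_nonneg)
  have "1 \<le> N l ^ degree Q * (\<Prod>x\<in>#A + B. N (poly (map_emb Q) x))"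
    by (rule resultant_ge_1[OF P Q split])
  also have "\<dots> \<le> N l ^ degree Q *
      ((\<Prod>x\<in>#A. N (poly (map_emb Q) x)) * (height Q ^ size B * ?m B ^ degree Q))"
    using B nonneg by (auto intro!: mult_left_mono simp: N_nonneg)
  also have "\<dots> = (\<Prod>x\<in>#A. N (poly (map_emb Q) x)) * (N l * (1 * ?m B)) ^ degree Q * height Q ^ size B"
    by (simp add: power_mult_distrib mult_ac)
  also have "\<dots> \<le> (\<Prod>x\<in>#A. N (poly (map_emb Q) x)) * height P ^ degree Q * height Q ^ size B"
    unfolding hP using ge_1[of A] ge_1[of B] nonneg
    by (intro mult_right_mono mult_left_mono power_mono) (auto simp: N_nonneg)
  finally show ?thesis .
qed

lemma resultant_bound_1:
  assumes "min_deg_poly a P" "poly (map_emb Q) a \<noteq> 0" "poly (map_emb P) x = 0"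
  shows "1 \<le> N (poly (map_emb Q) x) * height P ^ degree Q * height Q ^ (degree P - 1)"
proof -
  have "map_emb P \<noteq> 0"
    using min_deg_polyD(1)[OF assms(1)] by simp
  obtain G where G: "map_emb P = [:- x, 1:] * G"
    using assms(3) by (meson dvdE poly_eq_0_iff_dvd)
  then have "G \<noteq> 0"
    using \<open>map_emb P \<noteq> 0\<close> by auto
  then obtain B where B: "size B = degree G" "G = split_poly (lead_coeff G) B"
    using alg_closed_imp_factorization by blast
  have "map_emb P = split_poly (lead_coeff G) ({#x#} + B)"
    unfolding G by (subst B(2)) (simp only: image_mset_union prod_mset.union image_mset_single
        prod_mset_singleton mult_smult_right)
  moreover have "degree P = Suc (degree G)"
    using arg_cong[OF G, of degree] \<open>G \<noteq> 0\<close> by (simp add: degree_mult_eq del: mult_pCons_left)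
  ultimately show ?thesis
    using resultant_bound[OF assms(1,2)] B(1) by fastforce
qed

lemma resultant_bound_2:
  assumes "min_deg_poly a P" "poly (map_emb Q) a \<noteq> 0" "map_emb P = [:- x, 1:] * ([:- y, 1:] * G)"
  shows "1 \<le> N (poly (map_emb Q) x) * N (poly (map_emb Q) y) * height P ^ degree Q *
    height Q ^ (degree P - 2)"
proof -
  have "map_emb P \<noteq> 0"
    using min_deg_polyD(1)[OF assms(1)] by simp
  then have "G \<noteq> 0"
    using assms(3) by auto
  then obtain B where B: "size B = degree G" "G = split_poly (lead_coeff G) B"
    using alg_closed_imp_factorization by blast
  have "map_emb P = split_poly (lead_coeff G) ({#x, y#} + B)"
    unfolding assms(3) by (subst B(2)) (simp only: image_mset_union prod_mset.union image_mset_add_mset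
        image_mset_empty prod_mset.add_mset prod_mset_empty mult_1_right mult_smult_right mult.assoc)
  moreover have "degree P = Suc (Suc (degree G))"
    using arg_cong[OF assms(3), of degree] \<open>G \<noteq> 0\<close>
    by (simp add: degree_mult_eq del: mult_pCons_left)
  ultimately show ?thesis
    using resultant_bound[OF assms(1,2)] B(1) by fastforce
qed

end

subsection \<open>Polynomials with small values\<close>

context laurent_extension
begin

lemma map_emb_eq: "map_emb Q = map_poly j (map_poly poly_to_fls Q)"
  by (simp add: map_poly_map_poly o_def emb_def[abs_def])

lemma poly_map_emb_eq_j: "poly (map_emb Q) (j \<xi>) = j (poly (map_poly poly_to_fls Q) \<xi>)"
  by (simp add: map_emb_eq)

text \<open>Pigeonhole: two coefficient families whose values at \<xi> agree on a window of Laurent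
  coefficients have a difference with small value.\<close>

lemma small_value_poly:
  fixes \<xi> :: "'a fls"
  shows "\<exists>\<kappa>>0. \<forall>h\<ge>1. \<exists>Q. Q \<noteq> 0 \<and> degree Q \<le> m \<and>
    (\<forall>i. coeff Q i = 0 \<or> degree (coeff Q i) \<le> h - 1) \<and>
    N (poly (map_emb Q) (j \<xi>)) \<le> \<kappa> * (1 / q) ^ (h * m)"
proof -
  obtain s0 where s0: "max 1 (N (j \<xi>)) < q ^ s0"
    using real_arch_pow[OF q_gt_1] by blast
  \<comment> \<open>\<open>q ^ s\<close> bounds the effect of the powers of \<xi> on the size of a
    value, and becomes the constant \<kappa>.\<close>
  define s where "s = s0 * m"
  have s: "max 1 (N (j \<xi>)) ^ m \<le> q ^ s"
    using power_mono[OF less_imp_le[OF s0], of m] by (simp add: s_def power_mult)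
  have "\<exists>Q. Q \<noteq> 0 \<and> degree Q \<le> m \<and> (\<forall>i. coeff Q i = 0 \<or> degree (coeff Q i) \<le> h - 1) \<and>
    N (poly (map_emb Q) (j \<xi>)) \<le> q ^ s * (1 / q) ^ (h * m)" if h: "1 \<le> h" for h
  proof -
    define D where "D = {..m} \<times> {..<h}"
    define Z :: "(nat \<times> nat \<Rightarrow> 'a) \<Rightarrow> 'a poly poly"
      where "Z c = (\<Sum>i\<le>m. monom (\<Sum>k<h. monom (c (i, k)) k) i)" for c
    have coeff_Z: "coeff (Z c) i = (if i \<le> m then \<Sum>k<h. monom (c (i, k)) k else 0)" for c i
      unfolding Z_def by (simp add: coeff_sum)
    have coeff_coeff_Z: "coeff (coeff (Z c) i) k = (if i \<le> m \<and> k < h then c (i, k) else 0)" for c i k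
      by (simp add: coeff_Z coeff_sum)
    \<comment> \<open>The window runs from the lowest index at which a value can be nonzero to the
      target precision. It has h * m + h - 1 indices, one fewer than the free coefficients indexed
      by \<open>D\<close>.\<close>
    define I where "I = {- int (h - 1 + s)..<int (h * m) - int s}"
    define V where "V Q = poly (map_poly poly_to_fls Q) \<xi>" for Q
    define F where "F c = restrict (fls_nth (V (Z c))) I" for c
    have "card I = h * m + (h - 1)"
      unfolding I_def by (simp del: of_nat_add of_nat_mult)
    then have "card (PiE I (\<lambda>_. UNIV :: 'a set)) = CARD('a) ^ (h * m + (h - 1))"
      by (subst card_PiE) (auto simp: I_def)
    also have "\<dots> < CARD('a) ^ (Suc m * h)"
      using q_gt_1 h by (intro power_strict_increasing) (auto simp: q_def mult.commute)
    also have "\<dots> = card (PiE D (\<lambda>_. UNIV :: 'a set))"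
      by (subst card_PiE) (auto simp: D_def)
    finally have "card (PiE I (\<lambda>_. UNIV :: 'a set)) < card (PiE D (\<lambda>_. UNIV :: 'a set))" .
    moreover have "F ` (PiE D (\<lambda>_. UNIV)) \<subseteq> PiE I (\<lambda>_. UNIV)"
      by (auto simp: F_def)
    moreover have "finite (PiE I (\<lambda>_. UNIV :: 'a set))"
      by (intro finite_PiE) (auto simp: I_def)
    ultimately have "\<not> inj_on F (PiE D (\<lambda>_. UNIV))"
      using card_inj_on_le leD by blast
    then obtain c c' where c: "c \<in> PiE D (\<lambda>_. UNIV)" "c' \<in> PiE D (\<lambda>_. UNIV)" "c \<noteq> c'" "F c = F c'"
      by (auto simp: inj_on_def)
    define Q where "Q = Z c - Z c'"
    have "\<exists>x\<in>D. c x \<noteq> c' x"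
      using c PiE_ext by metis
    then obtain i k where "i \<le> m" "k < h" "c (i, k) \<noteq> c' (i, k)"
      by (auto simp: D_def)
    then have "coeff (coeff Q i) k \<noteq> 0"
      by (simp add: Q_def coeff_coeff_Z)
    then have "Q \<noteq> 0"
      by auto
    moreover have deg: "degree Q \<le> m"
      by (intro degree_le) (simp add: Q_def coeff_Z)
    moreover have small: "degree (coeff Q i) \<le> h - 1" for i
      using h by (intro degree_le) (auto simp: Q_def coeff_coeff_Z)
    moreover have "N (poly (map_emb Q) (j \<xi>)) \<le> q ^ s * (1 / q) ^ (h * m)"
    proof -
      have "N (j (V Q)) \<le> gnorm (map_emb Q) * max 1 (N (j \<xi>)) ^ m"
        using deg N_poly_le[of "map_emb Q" m "j \<xi>"] by (simp add: V_def poly_map_emb_eq_j)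
      also have "\<dots> \<le> q ^ (h - 1) * q ^ s"
        using height_leI[of Q "h - 1"] small s q_gt_1
        by (intro mult_mono) (auto simp: height_eq_gnorm)
      also have "\<dots> = q powr (- of_int (- int (h - 1 + s)))"
        using q_gt_1 by (simp add: powr_realpow power_add del: of_nat_add)
      finally have low: "fls_nth (V Q) i = 0" if "i < - int (h - 1 + s)" for i
        using fls_abs_le_iff[of "V Q" "- int (h - 1 + s)"] that by (simp add: N_j q_def)
      have "V Q = V (Z c) - V (Z c')"
      proof -
        have "j (V Q) = j (V (Z c) - V (Z c'))"
          by (simp add: V_def Q_def j.hom_minus emb_poly.hom_minus flip: poly_map_emb_eq_j)
        then show ?thesis
          by simp
      qed
      moreover have "fls_nth (V (Z c)) i = fls_nth (V (Z c')) i" if "i \<in> I" for i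
        using c(4) that by (metis F_def restrict_apply')
      ultimately have "fls_nth (V Q) i = 0" if "i < int (h * m) - int s" for i
        using low[of i] that by (cases "i \<in> I") (auto simp: I_def)
      then have "fls_abs (V Q) \<le> q powr (- of_int (int (h * m) - int s))"
        using fls_abs_le_iff[of "V Q" "int (h * m) - int s"] by (simp add: q_def)
      also have "\<dots> = q powr real s * q powr (- real (h * m))"
        by (simp flip: powr_add)
      also have "\<dots> = q ^ s * (1 / q) ^ (h * m)"
        using q_gt_1 powr_neg_nat[of "h * m"] by (simp add: powr_realpow)
      finally show ?thesis
        by (simp add: V_def poly_map_emb_eq_j N_j)
    qed
    ultimately show ?thesis
      by blast
  qed
  moreover have "0 < q ^ s"
    using q_gt_1 by simp
  ultimately show ?thesis
    by blast
qed

end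

subsection \<open>Descent to approximations in the base field\<close>

context laurent_extension
begin

lemma second_root_of_irrational_emb_root:
  assumes "P \<noteq> 0" "poly (map_emb P) a = 0" "a \<notin> range j"
  shows "\<exists>c G. map_emb P = [:- a, 1:] * ([:- c, 1:] * G) \<and> N (j \<xi> - c) \<le> N (j \<xi> - a)"
proof -
  have "map_poly poly_to_fls P \<noteq> 0"
  proof
    assume "map_poly poly_to_fls P = 0"
    then have "map_emb P = 0"
      unfolding map_emb_eq by simp
    then show False
      using assms(1) by simp
  qed
  from second_root_of_irrational_root[OF this, folded map_emb_eq, OF assms(2,3)] show ?thesis .
qed

definition algebraic_le :: "nat \<Rightarrow> 'l \<Rightarrow> bool" where
  "algebraic_le n a \<longleftrightarrow> algebraic_via emb a \<and> alg_degree emb a \<le> n"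

lemma algebraic_leI: "Q \<noteq> 0 \<Longrightarrow> poly (map_emb Q) a = 0 \<Longrightarrow> degree Q \<le> n \<Longrightarrow> algebraic_le n a"
  by (auto simp: algebraic_le_def intro: root_algebraic order_trans[OF alg_degree_le])

text \<open>Either Q has a root as near to \<xi> as a, or its values at two roots of P equal its
  value at \<xi> in norm and \<open>resultant_bound_2\<close> yields H \<le> \<kappa>.\<close>

lemma descent_step:
  fixes \<xi> :: "'a fls"
  assumes small: "\<And>h. 1 \<le> h \<Longrightarrow> \<exists>Q. Q \<noteq> 0 \<and> degree Q \<le> n \<and>
      (\<forall>i. coeff Q i = 0 \<or> degree (coeff Q i) \<le> h - 1) \<and>
      N (poly (map_emb Q) (j \<xi>)) \<le> \<kappa> * (1 / q) ^ (h * n)"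
    and "algebraic_le n a" "a \<notin> range j" and large: "1 < alg_height emb a" "\<kappa> < alg_height emb a"
  shows "\<exists>b. algebraic_le n b \<and> N (j \<xi> - b) \<le> N (j \<xi> - a) \<and> alg_height emb b < alg_height emb a"
proof -
  define P where "P = min_poly emb a"
  define H where "H = alg_height emb a"
  have P: "min_deg_poly a P" and deg_P: "degree P \<le> n"
    using assms(2) min_deg_poly_min_poly by (auto simp: P_def algebraic_le_def alg_degree_def)
  have hP: "height P = H"
    by (simp add: P_def H_def alg_height_def)
  obtain h where h: "H = q ^ h"
    using height_power[OF min_deg_polyD(1)[OF P]] hP by auto
  \<comment> \<open>With h positive, coefficients of degree at most h - 1 give Q a height strictly
    below H.\<close>
  have "h \<noteq> 0"
    using large(1) h by (intro notI) (simp add: H_def)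
  then obtain Q where "Q \<noteq> 0" and deg_Q: "degree Q \<le> n"
    and coeffs: "\<And>i. coeff Q i = 0 \<or> degree (coeff Q i) \<le> h - 1"
    and Q_small: "N (poly (map_emb Q) (j \<xi>)) \<le> \<kappa> * (1 / q) ^ (h * n)"
    using small[of h] by auto
  have "height Q \<le> q ^ (h - 1)"
    using coeffs by (rule height_leI)
  also have "\<dots> < H"
    unfolding h using q_gt_1 \<open>h \<noteq> 0\<close> by (intro power_strict_increasing) auto
  finally have hQ: "height Q < H" .
  have "\<exists>b. poly (map_emb Q) b = 0 \<and> N (j \<xi> - b) \<le> N (j \<xi> - a)"
  proof (rule ccontr)
    assume contra: "\<not> ?thesis"
    let ?v = "N (poly (map_emb Q) (j \<xi>))"
    have eq: "N (poly (map_emb Q) y) = ?v" if "N (j \<xi> - y) \<le> N (j \<xi> - a)" for y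
      using contra that by (intro N_poly_eq_of_far_roots[of _ "N (j \<xi> - a)"]) (auto simp: not_le)
    obtain c G where G: "map_emb P = [:- a, 1:] * ([:- c, 1:] * G)" and c: "N (j \<xi> - c) \<le> N (j \<xi> - a)"
      using second_root_of_irrational_emb_root[OF min_deg_polyD(1,2)[OF P] assms(3)] by blast
    have "G \<noteq> 0"
      using min_deg_polyD(1)[OF P] G by auto
    then have "degree P = Suc (Suc (degree G))"
      using arg_cong[OF G, of degree] by (simp add: degree_mult_eq del: mult_pCons_left)
    \<comment> \<open>Makes the truncated subtraction n - 2 genuine, so that multiplying by the
      square of H below completes a square.\<close>
    then have "2 \<le> n"
      using deg_P by simp
    have "poly (map_emb Q) a \<noteq> 0"
      using contra by blast
    from resultant_bound_2[OF P this G]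
    have "1 \<le> ?v * ?v * H ^ degree Q * height Q ^ (degree P - 2)"
      using eq[of a] eq[OF c] by (simp add: hP)
    also have "\<dots> \<le> ?v * ?v * H ^ n * H ^ (n - 2)"
    proof (intro mult_mono)
      have "height Q ^ (degree P - 2) \<le> H ^ (degree P - 2)"
        using hQ height_pos[OF \<open>Q \<noteq> 0\<close>] by (intro power_mono) auto
      also have "\<dots> \<le> H ^ (n - 2)"
        using deg_P large(1) by (intro power_increasing) (auto simp: H_def)
      finally show "height Q ^ (degree P - 2) \<le> H ^ (n - 2)" .
      show "H ^ degree Q \<le> H ^ n"
        using deg_Q large(1) by (intro power_increasing) (auto simp: H_def)
    qed (use height_pos[OF \<open>Q \<noteq> 0\<close>] large(1) in \<open>auto simp: H_def N_nonneg\<close>)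
    finally have "1 * H\<^sup>2 \<le> ?v * ?v * H ^ n * H ^ (n - 2) * H\<^sup>2"
      by (rule mult_right_mono) simp
    also have "\<dots> = ?v * ?v * H ^ n * H ^ (n - 2 + 2)"
      by (simp only: power_add mult.assoc)
    also have "\<dots> = (?v * H ^ n)\<^sup>2"
      unfolding le_add_diff_inverse2[OF \<open>2 \<le> n\<close>] by (simp add: power2_eq_square)
    finally have "H\<^sup>2 \<le> (?v * H ^ n)\<^sup>2"
      by simp
    moreover have "?v * H ^ n \<le> \<kappa>"
    proof -
      have "?v * H ^ n \<le> \<kappa> * (1 / q) ^ (h * n) * H ^ n"
        using Q_small large(1) by (intro mult_right_mono) (auto simp: H_def)
      then show ?thesis
        using q_gt_1 by (simp add: h power_divide flip: power_mult)
    qed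
    moreover have "0 \<le> ?v * H ^ n"
      using large(1) by (auto simp: H_def N_nonneg)
    ultimately have "H \<le> \<kappa>"
      using power2_le_imp_le[of H "?v * H ^ n"] by linarith
    then show False
      using large(2) by (simp add: H_def)
  qed
  then obtain b where b: "poly (map_emb Q) b = 0" "N (j \<xi> - b) \<le> N (j \<xi> - a)"
    by blast
  have "alg_height emb b < alg_height emb a"
    using alg_height_le[OF \<open>Q \<noteq> 0\<close> b(1)] hQ by (simp add: H_def)
  then show ?thesis
    using b algebraic_leI[OF \<open>Q \<noteq> 0\<close> b(1) deg_Q] by blast
qed

text \<open>Among the finitely many elements no farther from \<xi> and no higher than a, one of
  least height admits no further descent. The distance hypothesis keeps its height above the
  threshold of \<open>descent_step\<close>, so it must lie in the base field.\<close>

lemma descent_to_rational: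
  fixes \<xi> :: "'a fls"
  shows "\<exists>\<kappa>. \<forall>a. algebraic_le n a \<longrightarrow>
    (\<forall>b. algebraic_le n b \<longrightarrow> alg_height emb b \<le> \<kappa> \<longrightarrow> N (j \<xi> - a) < N (j \<xi> - b)) \<longrightarrow>
    (\<exists>b\<in>range j. algebraic_le n b \<and> N (j \<xi> - b) \<le> N (j \<xi> - a) \<and> alg_height emb b \<le> alg_height emb a)"
proof -
  obtain \<kappa> where \<kappa>: "\<And>h. 1 \<le> h \<Longrightarrow> \<exists>Q. Q \<noteq> 0 \<and> degree Q \<le> n \<and>
      (\<forall>i. coeff Q i = 0 \<or> degree (coeff Q i) \<le> h - 1) \<and>
      N (poly (map_emb Q) (j \<xi>)) \<le> \<kappa> * (1 / q) ^ (h * n)"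
    using small_value_poly[of n \<xi>] by blast
  show ?thesis
  proof (intro exI[of _ "max 1 \<kappa>"] allI impI)
    fix a
    assume a: "algebraic_le n a"
      and far: "\<forall>b. algebraic_le n b \<longrightarrow> alg_height emb b \<le> max 1 \<kappa> \<longrightarrow> N (j \<xi> - a) < N (j \<xi> - b)"
    define S where "S = {b. algebraic_le n b \<and> N (j \<xi> - b) \<le> N (j \<xi> - a) \<and> alg_height emb b \<le> alg_height emb a}"
    have "finite S"
      by (rule finite_subset[OF _ finite_bounded_degree_height[of n "alg_height emb a"]])
        (auto simp: S_def algebraic_le_def)
    moreover have "a \<in> S"
      using a by (simp add: S_def)
    ultimately obtain b where b: "b \<in> S" and least: "\<And>c. c \<in> S \<Longrightarrow> alg_height emb b \<le> alg_height emb c"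
      using ex_min_if_finite[of "alg_height emb ` S"] by (auto simp: not_less)
    have "b \<in> range j"
    proof (rule ccontr)
      assume "b \<notin> range j"
      moreover have "max 1 \<kappa> < alg_height emb b"
        using far b by (force simp: S_def)
      ultimately obtain c where "algebraic_le n c" "N (j \<xi> - c) \<le> N (j \<xi> - b)"
        "alg_height emb c < alg_height emb b"
        using descent_step[OF \<kappa>, of b] b by (auto simp: S_def)
      then show False
        using least[of c] b by (auto simp: S_def)
    qed
    then show "\<exists>b\<in>range j. algebraic_le n b \<and> N (j \<xi> - b) \<le> N (j \<xi> - a) \<and> alg_height emb b \<le> alg_height emb a"
      using b by (auto simp: S_def)
  qed
qed

text \<open>The solutions behind \<open>w_at\<close>, pulled back to the algebraic closure; those in
  \<open>range j\<close> correspond to the solutions behind \<open>w_star\<close>.\<close>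

definition approx_set :: "nat \<Rightarrow> 'a fls \<Rightarrow> real \<Rightarrow> 'l set" where
  "approx_set n \<xi> w = {a. algebraic_le n a \<and> 0 < N (j \<xi> - a) \<and>
     N (j \<xi> - a) < alg_height emb a powr (- w - 1)}"

lemma infinite_algebraic_le_height:
  assumes "infinite A" "\<And>a. a \<in> A \<Longrightarrow> algebraic_le n a"
  shows "\<exists>a\<in>A. B < alg_height emb a"
proof (rule ccontr)
  assume "\<not> ?thesis"
  then have "A \<subseteq> {x. algebraic_via emb x \<and> alg_degree emb x \<le> n \<and> alg_height emb x \<le> B}"
    using assms(2) by (force simp: algebraic_le_def)
  then show False
    using finite_bounded_degree_height finite_subset assms(1) by blast
qed

text \<open>Infinitely many solutions have unbounded heights, and the exponent - w - 1 is
  negative.\<close>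

lemma approx_set_close:
  assumes "infinite (approx_set n \<xi> w)" "- 1 < w" "0 < e"
  shows "\<exists>a\<in>approx_set n \<xi> w. N (j \<xi> - a) < e"
proof -
  define B where "B = e powr (1 / (- w - 1))"
  have "0 < B"
    using assms(3) by (simp add: B_def)
  obtain a where a: "a \<in> approx_set n \<xi> w" "B < alg_height emb a"
    using infinite_algebraic_le_height[OF assms(1), of n B] by (auto simp: approx_set_def)
  have "N (j \<xi> - a) < alg_height emb a powr (- w - 1)"
    using a(1) by (simp add: approx_set_def)
  also have "\<dots> < B powr (- w - 1)"
    using a(2) \<open>0 < B\<close> assms(2) by (intro powr_less_mono2_neg) auto
  also have "\<dots> = e"
    using assms(2,3) by (simp add: B_def powr_powr)
  finally show ?thesis
    using a(1) by blast
qed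

text \<open>Descent from an approximation nearer than all elements of \<open>C\<close> ends at a
  rational point outside \<open>C\<close>. It is again a solution: its height is no larger, which
  only relaxes the inequality, and it differs from \<xi> by assumption.\<close>

lemma infinite_rational_approx_of_not_algebraic:
  assumes "\<not> algebraic_le n (j \<xi>)" and inf: "infinite (approx_set n \<xi> w)" and w: "- 1 < w"
  shows "infinite (approx_set n \<xi> w \<inter> range j)"
proof
  assume fin: "finite (approx_set n \<xi> w \<inter> range j)"
  obtain \<kappa> where \<kappa>: "\<And>a. algebraic_le n a \<Longrightarrow>
    (\<And>b. algebraic_le n b \<Longrightarrow> alg_height emb b \<le> \<kappa> \<Longrightarrow> N (j \<xi> - a) < N (j \<xi> - b)) \<Longrightarrow>
    \<exists>b\<in>range j. algebraic_le n b \<and> N (j \<xi> - b) \<le> N (j \<xi> - a) \<and> alg_height emb b \<le> alg_height emb a"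
    using descent_to_rational[of n \<xi>] by blast
  define C where "C = approx_set n \<xi> w \<inter> range j \<union> {b. algebraic_le n b \<and> alg_height emb b \<le> \<kappa>}"
  have "finite C"
    unfolding C_def using fin finite_bounded_degree_height[of n \<kappa>] by (simp add: algebraic_le_def conj_ac)
  have pos: "0 < N (j \<xi> - b)" if "algebraic_le n b" for b
    using assms(1) that by (intro N_pos) auto
  define e where "e = Min (insert 1 ((\<lambda>b. N (j \<xi> - b)) ` C))"
  have "0 < e"
    unfolding e_def using \<open>finite C\<close> pos by (subst Min_gr_iff) (auto simp: C_def approx_set_def)
  have e_le: "e \<le> N (j \<xi> - b)" if "b \<in> C" for b
    unfolding e_def using \<open>finite C\<close> that by (intro Min_le) auto
  obtain a where a: "a \<in> approx_set n \<xi> w" "N (j \<xi> - a) < e"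
    using approx_set_close[OF inf w \<open>0 < e\<close>] by blast
  have "N (j \<xi> - a) < N (j \<xi> - b)" if "algebraic_le n b" "alg_height emb b \<le> \<kappa>" for b
    using e_le[of b] a(2) that by (auto simp: C_def)
  then obtain b where b: "b \<in> range j" "algebraic_le n b" "N (j \<xi> - b) \<le> N (j \<xi> - a)"
    "alg_height emb b \<le> alg_height emb a"
    using \<kappa>[of a] a(1) by (auto simp: approx_set_def)
  have "N (j \<xi> - a) < alg_height emb a powr (- w - 1)"
    using a(1) by (simp add: approx_set_def)
  also have "\<dots> \<le> alg_height emb b powr (- w - 1)"
    using b(2,4) w alg_height_ge_1[of b] by (intro powr_mono2') (auto simp: algebraic_le_def)
  finally have "b \<in> approx_set n \<xi> w"
    using b(2,3) pos by (simp add: approx_set_def)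
  then show False
    using e_le[of b] a(2) b(1,3) by (simp add: C_def)
qed

end

subsection \<open>Separability\<close>

lemma prime_CHAR_finite_field: "prime CHAR('a::{field,finite})"
  by (rule prime_CHAR_semidom) (rule finite_imp_CHAR_pos[OF finite])

text \<open>Frobenius is injective, hence surjective on a finite set.\<close>

lemma finite_field_pth_root: "\<exists>d. c = d ^ CHAR('a)" for c :: "'a::{field,finite}"
proof -
  let ?p = "CHAR('a)"
  have "inj (\<lambda>x :: 'a. x ^ ?p)"
  proof (rule injI)
    fix x y :: 'a
    assume eq: "x ^ ?p = y ^ ?p"
    have "(x - y + y) ^ ?p = (x - y) ^ ?p + y ^ ?p"
      by (rule freshmans_dream) (simp_all add: prime_CHAR_finite_field)
    then have "(x - y) ^ ?p = 0"
      using eq by simp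
    then show "x = y"
      by simp
  qed
  then have "surj (\<lambda>x :: 'a. x ^ ?p)"
    by (simp add: finite_UNIV_inj_surj)
  then show ?thesis
    by (metis surjD)
qed

text \<open>Only exponents divisible by p occur, so the root is taken monomial by monomial and
  additivity of Frobenius reassembles f.\<close>

lemma pth_power_of_pderiv_eq_0:
  fixes f :: "'b::idom poly"
  assumes p: "prime CHAR('b)" and f: "pderiv f = 0" and roots: "\<And>i. \<exists>c. coeff f i = c ^ CHAR('b)"
  shows "\<exists>g. f = g ^ CHAR('b)"
proof -
  let ?p = "CHAR('b)"
  obtain c where c: "coeff f i = c i ^ ?p" for i
    using roots by metis
  have zero: "coeff f i = 0" if "\<not> ?p dvd i" for i
  proof -
    have "i \<noteq> 0"
      using that by (intro notI) simp
    then obtain k where k: "i = Suc k"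
      using not0_implies_Suc by blast
    have "of_nat i * coeff f i = 0"
      using arg_cong[OF f, of "\<lambda>g. coeff g k"] by (simp add: coeff_pderiv k)
    moreover have "of_nat i \<noteq> (0 :: 'b)"
      using that of_nat_eq_0_iff_char_dvd by blast
    ultimately show ?thesis
      by simp
  qed
  define g where "g = (\<Sum>i\<le>degree f. if ?p dvd i then monom (c i) (i div ?p) else 0)"
  have "g ^ ?p = (\<Sum>i\<le>degree f. (if ?p dvd i then monom (c i) (i div ?p) else 0) ^ ?p)"
    unfolding g_def by (rule freshmans_dream_sum) (simp_all add: p)
  also have "\<dots> = (\<Sum>i\<le>degree f. monom (coeff f i) i)"
  proof (rule sum.cong)
    fix i
    show "(if ?p dvd i then monom (c i) (i div ?p) else 0) ^ ?p = monom (coeff f i) i"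
      using zero[of i] prime_gt_0_nat[OF p] by (auto simp: monom_power zero_power simp flip: c)
  qed simp
  also have "\<dots> = f"
    by (rule poly_as_sum_of_monoms)
  finally show ?thesis
    by metis
qed

section \<open>Derivatives of polynomial expressions in T and a Laurent series\<close>

lemma poly_to_fls_pCons: "poly_to_fls (pCons a R) = fls_const a + fls_X_inv * poly_to_fls R"
  by (simp add: poly_to_fls_def Polynomial.map_poly_pCons)

text \<open>\<open>fls_deriv\<close> differentiates with respect to 1/T, and T has derivative - T^2
  in that variable.\<close>

lemma fls_deriv_poly_to_fls: "fls_deriv (poly_to_fls R) = - (fls_X_inv\<^sup>2 * poly_to_fls (pderiv R))"
  for R :: "'a::field poly"
proof (induction R)
  case (pCons a R)
  interpret p: comm_ring_hom "poly_to_fls :: 'a poly \<Rightarrow> 'a fls"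
    by (rule comm_ring_hom_poly_to_fls)
  show ?case
    by (simp add: poly_to_fls_pCons pderiv_pCons p.hom_add pCons.IH algebra_simps power2_eq_square)
qed simp

context laurent_extension
begin

abbreviation value_at :: "'a poly poly \<Rightarrow> 'a fls \<Rightarrow> 'a fls" where
  "value_at Q \<xi> \<equiv> poly (map_poly poly_to_fls Q) \<xi>"

lemma value_at_add: "value_at (P + Q) \<xi> = value_at P \<xi> + value_at Q \<xi>"
proof -
  interpret p: comm_ring_hom "poly_to_fls :: 'a poly \<Rightarrow> 'a fls"
    by (rule comm_ring_hom_poly_to_fls)
  show ?thesis
    by (simp add: p.map_poly_hom_add)
qed

lemma value_at_pCons: "value_at (pCons a Q) \<xi> = poly_to_fls a + \<xi> * value_at Q \<xi>"
  by (simp add: Polynomial.map_poly_pCons)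

text \<open>The chain rule for Q(T, \<xi>); \<open>map_poly pderiv Q\<close> is the partial
  derivative in T.\<close>

lemma fls_deriv_value_at:
  "fls_deriv (value_at Q \<xi>) =
    value_at (pderiv Q) \<xi> * fls_deriv \<xi> - fls_X_inv\<^sup>2 * value_at (map_poly pderiv Q) \<xi>"
proof (induction Q)
  case (pCons a Q)
  have 1: "value_at (map_poly pderiv (pCons a Q)) \<xi> =
      poly_to_fls (pderiv a) + \<xi> * value_at (map_poly pderiv Q) \<xi>"
    by (simp add: Polynomial.map_poly_pCons)
  have 2: "value_at (pderiv (pCons a Q)) \<xi> = value_at Q \<xi> + \<xi> * value_at (pderiv Q) \<xi>"
    unfolding pderiv_pCons value_at_add value_at_pCons by simp
  show ?case
    unfolding 1 2 value_at_pCons fls_deriv_add fls_deriv_mult fls_deriv_poly_to_fls pCons.IH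
    by (simp add: algebra_simps)
qed simp

text \<open>Every coefficient not killed by the derivative drops in degree. The strictness
  contradicts minimality of the height in \<open>min_poly_separable\<close>.\<close>

lemma height_map_pderiv_less:
  assumes "map_poly pderiv M \<noteq> 0"
  shows "height (map_poly pderiv M) < height (M :: 'a poly poly)"
proof -
  obtain i where i: "height (map_poly pderiv M) = N (emb (coeff (map_poly pderiv M) i))"
    using height_attained by blast
  define R where "R = coeff M i"
  have R: "coeff (map_poly pderiv M) i = pderiv R"
    by (simp add: R_def coeff_map_poly)
  then have "pderiv R \<noteq> 0"
    using height_pos[OF assms] i by auto
  then have "degree R \<noteq> 0"
    by (metis degree_eq_zeroE pderiv_pCons pderiv_0 pCons_0_0 add_0)
  then have "degree (pderiv R) < degree R"
    using degree_pderiv_le[of R] by simp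
  then have "N (emb (pderiv R)) < N (emb R)"
    using \<open>pderiv R \<noteq> 0\<close> \<open>degree R \<noteq> 0\<close> q_gt_1 by (subst (1 2) N_emb) auto
  also have "\<dots> \<le> height M"
    unfolding R_def by (rule N_emb_coeff_le_height)
  finally show ?thesis
    by (simp add: i R)
qed

text \<open>
  Laurent series that are algebraic are separable: otherwise both the derivative with respect to
  the variable of the minimal polynomial and its coefficientwise derivative with respect to \<open>T\<close>
  vanish, so that it is a \<open>p\<close>-th power.
\<close>

lemma min_poly_separable:
  assumes alg: "algebraic_via emb (j \<xi>)"
  shows "poly (map_emb (pderiv (min_poly emb (j \<xi>)))) (j \<xi>) \<noteq> 0"
proof
  define M where "M = min_poly emb (j \<xi>)"
  assume "poly (map_emb (pderiv (min_poly emb (j \<xi>)))) (j \<xi>) = 0"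
  then have root': "poly (map_emb (pderiv M)) (j \<xi>) = 0"
    by (simp add: M_def)
  have M: "min_deg_poly (j \<xi>) M"
    unfolding M_def using alg by (rule min_deg_poly_min_poly)
  note M_nz = min_deg_polyD(1)[OF M] and root = min_deg_polyD(2)[OF M]
  have "degree M \<noteq> 0"
  proof
    assume "degree M = 0"
    then obtain m where "M = [:m:]"
      by (rule degree_eq_zeroE)
    then show False
      using root M_nz by simp
  qed
  have dM: "pderiv M = 0"
  proof (rule ccontr)
    assume "pderiv M \<noteq> 0"
    then show False
      using min_deg_polyD(3)[OF M _ root'] degree_pderiv_le[of M] \<open>degree M \<noteq> 0\<close> by simp
  qed
  have tM: "map_poly pderiv M = 0"
  proof (rule ccontr)
    assume nz: "map_poly pderiv M \<noteq> 0"
    have "value_at M \<xi> = 0"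
      using root by (simp add: poly_map_emb_eq_j)
    \<comment> \<open>Differentiating M(T, \<xi>) = 0 leaves only the T-part, as the part containing
      the derivative of \<xi> vanishes with \<open>pderiv M\<close>.\<close>
    then have "value_at (map_poly pderiv M) \<xi> = 0"
      using fls_deriv_value_at[of M \<xi>] dM by simp
    then have "poly (map_emb (map_poly pderiv M)) (j \<xi>) = 0"
      by (simp add: poly_map_emb_eq_j)
    then have "alg_height emb (j \<xi>) \<le> height (map_poly pderiv M)"
      by (rule alg_height_le[OF nz])
    then show False
      using height_map_pderiv_less[OF nz] by (simp add: alg_height_def M_def)
  qed
  let ?p = "CHAR('a)"
  \<comment> \<open>Roots are extracted twice: first from the coefficients as polynomials in T, then
    from M as a polynomial in X.\<close>
  have "\<exists>c. coeff M i = c ^ CHAR('a poly)" for i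
  proof -
    have "pderiv (coeff M i) = 0"
      using arg_cong[OF tM, of "\<lambda>f. coeff f i"] by (simp add: coeff_map_poly)
    then show ?thesis
      using pth_power_of_pderiv_eq_0[of "coeff M i"] finite_field_pth_root prime_CHAR_finite_field
      by auto
  qed
  then obtain g where g: "M = g ^ ?p"
    using pth_power_of_pderiv_eq_0[OF _ dM] prime_CHAR_finite_field[where 'a = 'a] by auto
  have "g \<noteq> 0"
    using M_nz prime_gt_0_nat[OF prime_CHAR_finite_field[where 'a = 'a]] by (auto simp: g)
  have "poly (map_emb g) (j \<xi>) = 0"
    using root by (simp add: g emb_poly.hom_power)
  then have "degree M \<le> degree g"
    by (rule min_deg_polyD(3)[OF M \<open>g \<noteq> 0\<close>])
  moreover have "degree M = ?p * degree g"
    using \<open>g \<noteq> 0\<close> by (simp add: g degree_power_eq)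
  ultimately have "?p * degree g \<le> 1 * degree g" "0 < degree g"
    using \<open>degree M \<noteq> 0\<close> by auto
  then show False
    using prime_gt_1_nat[OF prime_CHAR_finite_field[where 'a = 'a]] by simp
qed

end

subsection \<open>Approximation of algebraic Laurent series\<close>

context laurent_extension
begin

text \<open>The resultant of M and the minimal polynomial P of a bounds P(x) from below, while P(x)
  = (x - a) G(x) with G(x) at most a constant times the height of a.\<close>

lemma liouville:
  fixes x :: 'l
  assumes x: "algebraic_via emb x"
  shows "\<exists>C\<ge>1. \<forall>a. algebraic_le n a \<longrightarrow> poly (map_emb (min_poly emb x)) a \<noteq> 0 \<longrightarrow>
    1 \<le> C * N (x - a) * alg_height emb a ^ alg_degree emb x"
proof -
  define M where "M = min_poly emb x"
  define r where "r = alg_degree emb x"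
  define K where "K = max 1 (N x)"
  have M: "min_deg_poly x M"
    unfolding M_def by (rule min_deg_poly_min_poly[OF x])
  have hM: "1 \<le> height M"
    by (rule height_ge_1[OF min_deg_polyD(1)[OF M]])
  have r: "r = degree M"
    by (simp add: r_def M_def alg_degree_def)
  have "r \<noteq> 0"
  proof
    assume "r = 0"
    then obtain m where "M = [:m:]"
      using r by (metis degree_eq_zeroE)
    then show False
      using min_deg_polyD(1,2)[OF M] by simp
  qed
  define C where "C = K ^ n * height M ^ n"
  have "1 \<le> C"
    using mult_mono[of 1 "K ^ n" 1 "height M ^ n"] hM by (simp add: C_def K_def)
  moreover have "1 \<le> C * N (x - a) * alg_height emb a ^ r"
    if a: "algebraic_le n a" and nz: "poly (map_emb M) a \<noteq> 0" for a
  proof -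
    define P where "P = min_poly emb a"
    define H where "H = alg_height emb a"
    have P: "min_deg_poly a P" and deg_P: "degree P \<le> n"
      using a min_deg_poly_min_poly by (auto simp: P_def algebraic_le_def alg_degree_def)
    have hP: "height P = H"
      by (simp add: P_def H_def alg_height_def)
    have "1 \<le> H"
      using height_ge_1[OF min_deg_polyD(1)[OF P]] hP by simp
    have "poly (map_emb P) x \<noteq> 0"
      using conjugate_root[OF P _ min_deg_polyD(2)[OF M]] nz by blast
    from resultant_bound_1[OF M this min_deg_polyD(2)[OF M]]
    have "1 \<le> N (poly (map_emb P) x) * height M ^ degree P * H ^ (r - 1)"
      unfolding hP r .
    also have "\<dots> \<le> (N (x - a) * H * K ^ n) * height M ^ n * H ^ (r - 1)"
    proof (intro mult_right_mono mult_mono)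
      obtain G where G: "map_emb P = [:- a, 1:] * G"
        using min_deg_polyD(2)[OF P] by (meson dvdE poly_eq_0_iff_dvd)
      have "G \<noteq> 0"
        using min_deg_polyD(1)[OF P] G by auto
      then have "degree G \<le> n"
        using arg_cong[OF G, of degree] deg_P by (simp add: degree_mult_eq del: mult_pCons_left)
      then have "N (poly G x) \<le> gnorm G * K ^ n"
        unfolding K_def by (rule N_poly_le)
      also have "\<dots> \<le> H * K ^ n"
        using gnorm_le_mult_linear[of G a] hP
        by (intro mult_right_mono) (simp_all add: height_eq_gnorm G K_def del: mult_pCons_left)
      finally have "N (x - a) * N (poly G x) \<le> N (x - a) * (H * K ^ n)"
        by (intro mult_left_mono N_nonneg)
      then show "N (poly (map_emb P) x) \<le> N (x - a) * H * K ^ n"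
        by (simp add: G poly_linear_mult N_mult mult.assoc del: mult_pCons_left)
      show "height M ^ degree P \<le> height M ^ n"
        using hM deg_P by (intro power_increasing)
    qed (use hM \<open>1 \<le> H\<close> in \<open>auto simp: N_nonneg K_def\<close>)
    also have "\<dots> = C * N (x - a) * (H * H ^ (r - 1))"
      by (simp add: C_def mult_ac)
    also have "H * H ^ (r - 1) = H ^ r"
      using \<open>r \<noteq> 0\<close> by (metis power_eq_if)
    finally show ?thesis
      by (simp add: H_def)
  qed
  ultimately show ?thesis
    unfolding M_def r_def by blast
qed

lemma approx_exponent_le_of_algebraic:
  fixes \<xi> :: "'a fls"
  assumes alg: "algebraic_via emb (j \<xi>)" and inf: "infinite (approx_set n \<xi> w)"
  shows "w \<le> real (alg_degree emb (j \<xi>)) - 1"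
proof (rule ccontr)
  define r where "r = alg_degree emb (j \<xi>)"
  assume "\<not> ?thesis"
  then have w: "0 < w + 1 - r"
    by (simp add: r_def)
  define M where "M = min_poly emb (j \<xi>)"
  obtain C where "1 \<le> C" and C: "\<And>a. algebraic_le n a \<Longrightarrow> poly (map_emb M) a \<noteq> 0 \<Longrightarrow>
      1 \<le> C * N (j \<xi> - a) * alg_height emb a ^ r"
    using liouville[OF alg, of n] unfolding M_def r_def by blast
  have "M \<noteq> 0"
    using min_deg_polyD(1)[OF min_deg_poly_min_poly[OF alg]] by (simp add: M_def)
  \<comment> \<open>Drops the conjugates of \<xi>, where Liouville's inequality does not apply;
    there are finitely many.\<close>
  define A where "A = approx_set n \<xi> w - {a. poly (map_emb M) a = 0}"
  have "infinite A"
    unfolding A_def using inf \<open>M \<noteq> 0\<close> by (intro Diff_infinite_finite poly_roots_finite) auto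
  moreover have "algebraic_le n a" if "a \<in> A" for a
    using that by (simp add: A_def approx_set_def)
  ultimately obtain a where a: "a \<in> A" "C powr (1 / (w + 1 - r)) < alg_height emb a"
    using infinite_algebraic_le_height by metis
  define H where "H = alg_height emb a"
  have "0 < C powr (1 / (w + 1 - r))"
    using \<open>1 \<le> C\<close> by simp
  then have "0 < H"
    using a(2) unfolding H_def by linarith
  have "1 \<le> C * N (j \<xi> - a) * H ^ r"
    using C a(1) by (simp add: A_def approx_set_def H_def)
  also have "\<dots> \<le> C * H powr (- w - 1) * H ^ r"
    using a(1) \<open>1 \<le> C\<close> \<open>0 < H\<close>
    by (intro mult_right_mono mult_left_mono) (auto simp: A_def approx_set_def H_def)
  also have "\<dots> = C * (H powr (- w - 1) * H powr real r)"
    using \<open>0 < H\<close> by (simp add: powr_realpow mult.assoc)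
  also have "\<dots> = C * H powr (- (w + 1 - r))"
    unfolding powr_add[symmetric] by (intro arg_cong2[of _ _ _ _ "(*)"] arg_cong2[of _ _ _ _ "(powr)"]) auto
  finally have "1 \<le> C / H powr (w + 1 - r)"
    unfolding powr_minus divide_inverse .
  moreover have "0 < H powr (w + 1 - r)"
    using \<open>0 < H\<close> by simp
  ultimately have "H powr (w + 1 - r) \<le> C"
    by (subst (asm) pos_le_divide_eq) auto
  moreover have "(C powr (1 / (w + 1 - r))) powr (w + 1 - r) < H powr (w + 1 - r)"
    using a(2) w by (intro powr_less_mono2) (auto simp: H_def)
  ultimately show False
    using w \<open>1 \<le> C\<close> by (simp add: powr_powr)
qed

text \<open>
  A perturbation \<open>T^(h + s) * M + B\<close> of a multiple of the minimal polynomial \<open>M\<close> by a polynomial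
  \<open>B\<close> of smaller degree that is small at \<open>\<xi>\<close> has a root close to \<open>\<xi>\<close> because \<open>M\<close> is separable.
\<close>

lemma perturbed_min_poly_root:
  fixes \<xi> :: "'a fls"
  assumes alg: "algebraic_via emb (j \<xi>)"
  defines "r \<equiv> alg_degree emb (j \<xi>)"
  shows "\<exists>C>0. \<exists>\<delta>>0. \<forall>h\<ge>1. \<exists>b. algebraic_le r b \<and> 0 < N (j \<xi> - b) \<and>
    N (j \<xi> - b) \<le> C * (1 / q) ^ (h * r) \<and> alg_height emb b \<le> C * q ^ h \<and>
    (N (j \<xi> - b) < \<delta> \<longrightarrow> b \<in> range j)"
proof -
  define M where "M = min_poly emb (j \<xi>)"
  define x where "x = j \<xi>"
  have M: "min_deg_poly x M"
    unfolding M_def x_def by (rule min_deg_poly_min_poly[OF alg])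
  have hM: "1 \<le> height M"
    by (rule height_ge_1[OF min_deg_polyD(1)[OF M]])
  have r: "r = degree M"
    by (simp add: r_def M_def alg_degree_def)
  have "r \<noteq> 0"
  proof
    assume "r = 0"
    then obtain m where "M = [:m:]"
      using r by (metis degree_eq_zeroE)
    then show False
      using min_deg_polyD(1,2)[OF M] by simp
  qed
  define K where "K = max 1 (N x) ^ r"
  have "1 \<le> K"
    by (simp add: K_def)
  have N_poly_le_K: "N (poly f x) \<le> gnorm f * K" if "degree f \<le> r" for f
    unfolding K_def by (rule N_poly_le[OF that])
  define \<mu> where "\<mu> = N (poly (map_emb (pderiv M)) x)"
  have "0 < \<mu>"
    unfolding \<mu>_def x_def M_def using min_poly_separable[OF alg] by (rule N_pos)
  \<comment> \<open>This s makes the derivative of \<open>T^(h + s) * M\<close> at \<xi> exceed that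
    of \<open>B\<close>.\<close>
  obtain s where "K / \<mu> < q ^ s"
    using real_arch_pow[OF q_gt_1] by blast
  then have s: "K < q ^ s * \<mu>"
    using \<open>0 < \<mu>\<close> by (simp add: field_simps)
  \<comment> \<open>Degree at most r - 1 keeps the nonzero \<open>B\<close> from vanishing at \<xi>.
    Its value of order q^(-h(r-1)), divided by a derivative of order q^h, gives the distance
    q^(-hr).\<close>
  obtain \<kappa> where "0 < \<kappa>" and \<kappa>: "\<And>h. 1 \<le> h \<Longrightarrow> \<exists>Q. Q \<noteq> 0 \<and> degree Q \<le> r - 1 \<and>
      (\<forall>i. coeff Q i = 0 \<or> degree (coeff Q i) \<le> h - 1) \<and>
      N (poly (map_emb Q) x) \<le> \<kappa> * (1 / q) ^ (h * (r - 1))"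
    using small_value_poly[of "r - 1" \<xi>] unfolding x_def by blast
  define c where "c = q ^ s * height M"
  have "1 \<le> c"
    unfolding c_def using hM q_gt_1 mult_mono[of 1 "q ^ s" 1 "height M"] by simp
  define C where "C = max c (2 * \<kappa> / (q ^ s * \<mu>))"
  define \<delta> where "\<delta> = q ^ s * \<mu> / (c * K)"
  have "\<exists>b. algebraic_le r b \<and> 0 < N (x - b) \<and> N (x - b) \<le> C * (1 / q) ^ (h * r) \<and>
      alg_height emb b \<le> C * q ^ h \<and> (N (x - b) < \<delta> \<longrightarrow> b \<in> range j)" if h: "1 \<le> h" for h
  proof -
    obtain B where "B \<noteq> 0" and deg_B: "degree B \<le> r - 1"
      and coeffs: "\<And>i. coeff B i = 0 \<or> degree (coeff B i) \<le> h - 1"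
      and B_small: "N (poly (map_emb B) x) \<le> \<kappa> * (1 / q) ^ (h * (r - 1))"
      using \<kappa>[OF h] by auto
    have hB: "height B \<le> q ^ (h - 1)"
      using coeffs by (rule height_leI)
    have "poly (map_emb B) x \<noteq> 0"
      using min_deg_polyD(3)[OF M \<open>B \<noteq> 0\<close>] deg_B \<open>r \<noteq> 0\<close> r by auto
    define t where "t = monom (1 :: 'a) (h + s)"
    have Nt: "N (emb t) = q ^ h * q ^ s"
      by (subst N_emb) (simp_all add: t_def degree_monom_eq power_add)
    define Q where "Q = smult t M + B"
    define F where "F = map_emb Q"
    have F: "F = smult (emb t) (map_emb M) + map_emb B"
      by (simp add: F_def Q_def emb_poly.hom_add emb.map_poly_hom_smult)
    have Fx: "poly F x = poly (map_emb B) x"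
      unfolding F using min_deg_polyD(2)[OF M] by simp
    then have Fx_nz: "poly F x \<noteq> 0"
      using \<open>poly (map_emb B) x \<noteq> 0\<close> by simp
    then have "Q \<noteq> 0"
      by (auto simp: F_def)
    have deg_Q: "degree Q \<le> r"
      unfolding Q_def using deg_B r by (intro degree_add_le order_trans[OF degree_smult_le]) auto
    then have deg_F: "degree F \<le> r"
      by (simp add: F_def)
    have hQ: "gnorm F \<le> c * q ^ h"
    proof (rule gnorm_leI)
      fix i
      have "N (emb t * coeff (map_emb M) i) \<le> q ^ h * q ^ s * height M"
        unfolding N_mult Nt height_eq_gnorm using q_gt_1
        by (intro mult_left_mono N_coeff_le_gnorm) simp
      moreover have "N (coeff (map_emb B) i) \<le> 1 * q ^ h"
      proof -
        have "N (coeff (map_emb B) i) \<le> q ^ (h - 1)"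
          using N_coeff_le_gnorm[of "map_emb B" i] hB by (simp add: height_eq_gnorm)
        also have "\<dots> \<le> q ^ h"
          using q_gt_1 by (intro power_increasing) auto
        finally show ?thesis
          by simp
      qed
      moreover have "1 * q ^ h \<le> c * q ^ h"
        using \<open>1 \<le> c\<close> q_gt_1 by (intro mult_right_mono) auto
      ultimately show "N (coeff F i) \<le> c * q ^ h"
        using N_add_le[of "emb t * coeff (map_emb M) i" "coeff (map_emb B) i"]
        unfolding F by (simp add: c_def mult_ac)
    qed
    have F'x: "N (poly (pderiv F) x) = q ^ h * q ^ s * \<mu>"
    proof -
      interpret emb: idom_hom emb ..
      have "N (poly (pderiv (map_emb B)) x) \<le> gnorm (pderiv (map_emb B)) * K"
        using degree_pderiv_le[of "map_emb B"] deg_B by (intro N_poly_le_K) simp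
      also have "\<dots> \<le> q ^ (h - 1) * K"
        using gnorm_pderiv_le[of "map_emb B"] hB \<open>1 \<le> K\<close>
        by (intro mult_right_mono) (auto simp: height_eq_gnorm)
      also have "\<dots> < q ^ h * (q ^ s * \<mu>)"
        using s \<open>1 \<le> K\<close> q_gt_1 h by (intro mult_le_less_imp_less power_increasing) auto
      also have "\<dots> = N (emb t * poly (map_emb (pderiv M)) x)"
        by (simp add: N_mult Nt \<mu>_def)
      finally have "N (emb t * poly (map_emb (pderiv M)) x + poly (pderiv (map_emb B)) x) =
          N (emb t * poly (map_emb (pderiv M)) x)"
        by (rule N_add_eq)
      moreover have "poly (pderiv F) x = emb t * poly (map_emb (pderiv M)) x + poly (pderiv (map_emb B)) x"
        unfolding F by (simp add: pderiv_add pderiv_smult emb.map_poly_pderiv)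
      ultimately show ?thesis
        by (simp add: N_mult Nt \<mu>_def)
    qed
    \<comment> \<open>With the factor 2, absence of roots within \<rho> would give 2 |F(x)| \<le>
      |F(x)| by the bound on the logarithmic derivative.\<close>
    define \<rho> where "\<rho> = 2 * (N (poly F x) / N (poly (pderiv F) x))"
    have F'_pos: "0 < N (poly (pderiv F) x)"
      unfolding F'x using \<open>0 < \<mu>\<close> q_gt_1 by simp
    have "\<exists>b. poly F b = 0 \<and> N (x - b) < \<rho>"
    proof (rule ccontr)
      assume "\<not> ?thesis"
      then have "N (poly (pderiv F) x) * \<rho> \<le> N (poly F x)"
        using F'_pos by (intro N_pderiv_le_of_far_roots) (auto simp: not_less \<rho>_def N_nonneg)
      then show False
        using F'_pos N_pos[OF Fx_nz] by (auto simp: \<rho>_def split: if_splits)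
    qed
    then obtain b where b: "poly F b = 0" "N (x - b) < \<rho>"
      by blast
    have "algebraic_le r b"
      using algebraic_leI[OF \<open>Q \<noteq> 0\<close> _ deg_Q] b(1) by (simp add: F_def)
    moreover have "0 < N (x - b)"
      using b(1) Fx_nz by (intro N_pos) auto
    moreover have "N (x - b) \<le> C * (1 / q) ^ (h * r)"
    proof -
      have "\<rho> \<le> 2 * (\<kappa> * (1 / q) ^ (h * (r - 1)) / (q ^ h * q ^ s * \<mu>))"
        unfolding \<rho>_def F'x Fx using B_small \<open>0 < \<mu>\<close> q_gt_1
        by (intro mult_left_mono divide_right_mono) auto
      also have "\<dots> = 2 * \<kappa> / (q ^ s * \<mu>) * ((1 / q) ^ (h * (r - 1)) * (1 / q) ^ h)"
        by (simp add: power_divide)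
      also have "(1 / q) ^ (h * (r - 1)) * (1 / q) ^ h = (1 / q) ^ (h * r)"
        using \<open>r \<noteq> 0\<close> by (simp add: right_diff_distrib' flip: power_add)
      also have "2 * \<kappa> / (q ^ s * \<mu>) * (1 / q) ^ (h * r) \<le> C * (1 / q) ^ (h * r)"
        using q_gt_1 by (intro mult_right_mono) (auto simp: C_def)
      finally show ?thesis
        using b(2) by simp
    qed
    moreover have "alg_height emb b \<le> C * q ^ h"
    proof -
      have "alg_height emb b \<le> height Q"
        using alg_height_le[OF \<open>Q \<noteq> 0\<close>] b(1) by (simp add: F_def)
      also have "\<dots> \<le> c * q ^ h"
        using hQ by (simp add: F_def height_eq_gnorm)
      also have "\<dots> \<le> C * q ^ h"
        using q_gt_1 by (intro mult_right_mono) (auto simp: C_def)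
      finally show ?thesis .
    qed
    \<comment> \<open>Otherwise a second root as near as b would make the derivative of F at \<xi>
      small, against its known size; \<delta> is the distance at which the two estimates
      collide.\<close>
    moreover have "b \<in> range j" if close: "N (x - b) < \<delta>"
    proof (rule ccontr)
      assume "b \<notin> range j"
      then obtain d G where G: "F = [:- b, 1:] * ([:- d, 1:] * G)" and d: "N (x - d) \<le> N (x - b)"
        using second_root_of_irrational_emb_root[OF \<open>Q \<noteq> 0\<close>, of b \<xi>] b(1)
        unfolding F_def x_def by blast
      define L where "L = [:- d, 1:] * G"
      have "F \<noteq> 0"
        using Fx_nz by auto
      then have "G \<noteq> 0" "L \<noteq> 0"
        using G by (auto simp: L_def)
      have "degree F = Suc (degree L)" "degree L = Suc (degree G)"
        using \<open>G \<noteq> 0\<close> \<open>L \<noteq> 0\<close> unfolding G L_def by (simp_all add: degree_mult_eq del: mult_pCons_left)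
      then have deg: "degree L \<le> r" "degree G \<le> r"
        using deg_F by auto
      have L_le: "gnorm L \<le> c * q ^ h" and G_le: "gnorm G \<le> c * q ^ h"
        using gnorm_le_mult_linear[of L b] gnorm_le_mult_linear[of G d] hQ
        unfolding G L_def[symmetric] by linarith+
      have "N ((x - d) * poly G x) \<le> N (x - b) * (c * q ^ h * K)"
        unfolding N_mult using d N_poly_le_K[OF deg(2)] G_le \<open>1 \<le> K\<close>
        by (intro mult_mono order_trans[OF _ mult_right_mono[OF G_le]]) (auto simp: N_nonneg)
      moreover have "N ((x - b) * poly (pderiv L) x) \<le> N (x - b) * (c * q ^ h * K)"
      proof -
        have "N (poly (pderiv L) x) \<le> gnorm (pderiv L) * K"
          using degree_pderiv_le[of L] deg(1) by (intro N_poly_le_K) simp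
        also have "\<dots> \<le> c * q ^ h * K"
          using gnorm_pderiv_le[of L] L_le \<open>1 \<le> K\<close> by (intro mult_right_mono) auto
        finally show ?thesis
          unfolding N_mult by (intro mult_left_mono N_nonneg)
      qed
      moreover have "poly (pderiv F) x = (x - d) * poly G x + (x - b) * poly (pderiv L) x"
        unfolding G L_def[symmetric] pderiv_mult
        by (simp add: pderiv_pCons L_def poly_linear_mult algebra_simps del: mult_pCons_left)
      ultimately have "q ^ h * q ^ s * \<mu> \<le> N (x - b) * (c * q ^ h * K)"
        unfolding F'x[symmetric] using N_add_le[of "(x - d) * poly G x" "(x - b) * poly (pderiv L) x"]
        by simp
      then have "q ^ s * \<mu> \<le> N (x - b) * (c * K)"
        using q_gt_1 by (simp add: mult_ac)
      then have "\<delta> \<le> N (x - b)"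
        using \<open>1 \<le> c\<close> \<open>1 \<le> K\<close> by (simp add: \<delta>_def pos_divide_le_eq)
      then show False
        using close by simp
    qed
    ultimately show ?thesis
      by blast
  qed
  moreover have "0 < C"
    using \<open>1 \<le> c\<close> by (simp add: C_def)
  moreover have "0 < \<delta>"
    using \<open>1 \<le> c\<close> \<open>1 \<le> K\<close> \<open>0 < \<mu>\<close> q_gt_1 by (simp add: \<delta>_def)
  ultimately show ?thesis
    unfolding x_def by blast
qed

text \<open>The perturbed polynomials yield points of height O(q^h) at distance O(q^(-hr)). For w <
  r - 1 and large h such a point is a solution, nearer than any in the supposedly finite
  set.\<close>

lemma infinite_rational_approx_of_algebraic:
  fixes \<xi> :: "'a fls"
  assumes alg: "algebraic_le n (j \<xi>)" and w: "- 1 < w" "w < real (alg_degree emb (j \<xi>)) - 1"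
  shows "infinite (approx_set n \<xi> w \<inter> range j)"
proof
  define r where "r = alg_degree emb (j \<xi>)"
  assume fin: "finite (approx_set n \<xi> w \<inter> range j)"
  obtain C \<delta> where "0 < C" "0 < \<delta>" and roots: "\<And>h. 1 \<le> h \<Longrightarrow> \<exists>b. algebraic_le r b \<and> 0 < N (j \<xi> - b) \<and>
    N (j \<xi> - b) \<le> C * (1 / q) ^ (h * r) \<and> alg_height emb b \<le> C * q ^ h \<and>
    (N (j \<xi> - b) < \<delta> \<longrightarrow> b \<in> range j)"
    using perturbed_min_poly_root[of \<xi>] alg unfolding algebraic_le_def r_def by blast
  define e where "e = Min (insert \<delta> ((\<lambda>b. N (j \<xi> - b)) ` (approx_set n \<xi> w \<inter> range j)))"
  have "0 < e"
    unfolding e_def using fin \<open>0 < \<delta>\<close> by (subst Min_gr_iff) (auto simp: approx_set_def)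
  have e_le: "e \<le> \<delta>" "\<And>b. b \<in> approx_set n \<xi> w \<inter> range j \<Longrightarrow> e \<le> N (j \<xi> - b)"
    unfolding e_def using fin by (auto intro!: Min_le)
  define g where "g = real r - w - 1"
  have "0 < g"
    using w(2) by (simp add: g_def r_def)
  have "0 < r"
    using w by (simp add: r_def)
  have "1 < q powr g"
    using q_gt_1 \<open>0 < g\<close> by simp
  \<comment> \<open>\<open>h1\<close> lets the gain \<open>g\<close> in the exponent absorb the
    constants; \<open>h2\<close> brings the root within distance e.\<close>
  obtain h1 where h1: "C * C powr (w + 1) < (q powr g) ^ h1"
    using real_arch_pow[OF \<open>1 < q powr g\<close>] by blast
  obtain h2 where h2: "C / e < q ^ h2"
    using real_arch_pow[OF q_gt_1] by blast
  define h where "h = max 1 (max h1 h2)"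
  have h: "1 \<le> h" "h1 \<le> h" "h2 \<le> h"
    by (auto simp: h_def)
  obtain b where b: "algebraic_le r b" "0 < N (j \<xi> - b)" "N (j \<xi> - b) \<le> C * (1 / q) ^ (h * r)"
    "alg_height emb b \<le> C * q ^ h" "N (j \<xi> - b) < \<delta> \<longrightarrow> b \<in> range j"
    using roots[OF h(1)] by blast
  have "C / e < q ^ h"
    using h2 power_increasing[OF h(3), of q] q_gt_1 by linarith
  also have "q ^ h \<le> q ^ (h * r)"
    using \<open>0 < r\<close> q_gt_1 by (intro power_increasing) auto
  finally have "C * (1 / q) ^ (h * r) < e"
    using \<open>0 < e\<close> q_gt_1 by (simp add: field_simps power_divide)
  then have close: "N (j \<xi> - b) < e"
    using b(3) by simp
  then have "b \<in> range j"
    using b(5) e_le(1) by simp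
  have "1 \<le> alg_height emb b"
    using b(1) by (simp add: algebraic_le_def alg_height_ge_1)
  have "(q powr g) ^ h1 \<le> (q powr g) ^ h"
    using h(2) \<open>1 < q powr g\<close> by (intro power_increasing) auto
  then have "C * C powr (w + 1) < (q powr g) ^ h"
    using h1 by linarith
  then have "C * C powr (w + 1) < q powr (g * h)"
    using q_gt_1 by (simp add: powr_powr flip: powr_realpow)
  then have "C * C powr (w + 1) * q powr (- (real h * real r)) <
      q powr (g * h) * q powr (- (real h * real r))"
    using q_gt_1 by (intro mult_strict_right_mono) auto
  also have "\<dots> = q powr (g * h + - (real h * real r))"
    by (rule powr_add[symmetric])
  also have "g * h + - (real h * real r) = real h * (- w - 1)"
    by (simp add: g_def algebra_simps)
  also have "q powr (real h * (- w - 1)) = (q powr h) powr (- w - 1)"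
    by (simp add: powr_powr)
  finally have "C powr (- w - 1) * (C * C powr (w + 1) * q powr (- (real h * real r))) <
      C powr (- w - 1) * (q powr h) powr (- w - 1)"
    using \<open>0 < C\<close> by (intro mult_strict_left_mono) auto
  moreover have "C powr (- w - 1) * C powr (w + 1) = 1"
    using \<open>0 < C\<close> by (simp flip: powr_add)
  then have "C powr (- w - 1) * (C * C powr (w + 1) * q powr (- (real h * real r))) =
      C * q powr (- (real h * real r))"
    by (metis (no_types, opaque_lifting) mult.assoc mult.left_commute mult_1)
  ultimately have "C * q powr (- (real h * real r)) < C powr (- w - 1) * (q powr h) powr (- w - 1)"
    by simp
  also have "\<dots> = (C * q ^ h) powr (- w - 1)"
    using \<open>0 < C\<close> q_gt_1 by (simp add: powr_mult powr_realpow)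
  also have "\<dots> \<le> alg_height emb b powr (- w - 1)"
    using b(4) \<open>1 \<le> alg_height emb b\<close> w(1) by (intro powr_mono2') auto
  finally have "N (j \<xi> - b) < alg_height emb b powr (- w - 1)"
    using b(3) powr_neg_nat[of "h * r"] by simp
  moreover have "algebraic_le n b"
    using b(1) alg by (simp add: algebraic_le_def r_def)
  ultimately have "b \<in> approx_set n \<xi> w"
    using b(2) by (simp add: approx_set_def)
  then show False
    using e_le(2)[of b] close \<open>b \<in> range j\<close> by simp
qed

text \<open>Here the exponent - w - 1 is positive, so points at bounded distance suffice once their
  heights are large. The powers of 1/T serve, being roots of T^m X - 1.\<close>

lemma infinite_rational_approx_below_minus_1:
  fixes \<xi> :: "'a fls"
  assumes "w < - 1" "1 \<le> n"
  shows "infinite (approx_set n \<xi> w \<inter> range j)"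
proof
  assume fin: "finite (approx_set n \<xi> w \<inter> range j)"
  define K where "K = max 1 (N (j \<xi>))"
  define a where "a m = j (fls_X ^ m)" for m :: nat
  have "inj a"
    by (rule injI) (auto simp: a_def dest: arg_cong[of _ _ fls_subdegree])
  have a: "algebraic_le n (a m)" for m
  proof -
    define Q where "Q = [:- 1, monom (1 :: 'a) m:]"
    have "poly_to_fls (monom (1 :: 'a) m) = fls_X_inv ^ m"
      by (simp add: poly_to_fls_def map_poly_monom poly_monom)
    then have "poly_to_fls (monom (1 :: 'a) m) * fls_X ^ m = 1"
      by (simp add: fls_X_inv_times_conv_shift flip: power_mult_distrib)
    then have "emb (monom 1 m) * a m = 1"
      unfolding emb_def a_def by (simp only: j_mult[symmetric] j_one)
    then have "poly (map_emb Q) (a m) = 0"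
      by (simp add: Q_def Polynomial.map_poly_pCons emb.hom_uminus mult.commute)
    then show ?thesis
      using assms(2) by (intro algebraic_leI[of Q]) (auto simp: Q_def)
  qed
  have "infinite (range a - {j \<xi>} - (approx_set n \<xi> w \<inter> range j))"
    using \<open>inj a\<close> fin by (simp add: finite_image_iff)
  from infinite_algebraic_le_height[OF this, of n "K powr (1 / (- w - 1))"]
  obtain b where b: "b \<in> range a - {j \<xi>} - (approx_set n \<xi> w \<inter> range j)"
    "K powr (1 / (- w - 1)) < alg_height emb b"
    using a by auto
  obtain m where m: "b = a m"
    using b(1) by auto
  have "fls_abs (fls_X ^ m :: 'a fls) \<le> 1"
    using fls_abs_le_iff[of "fls_X ^ m :: 'a fls" 0] by simp
  then have "N b \<le> 1"
    by (simp add: m a_def N_j)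
  then have "N (j \<xi> - b) \<le> K"
    using N_diff_le[of "j \<xi>" b] by (simp add: K_def)
  also have "K = (K powr (1 / (- w - 1))) powr (- w - 1)"
    using assms(1) by (simp add: K_def powr_powr)
  also have "\<dots> < alg_height emb b powr (- w - 1)"
    using b(2) assms(1) by (intro powr_less_mono2) auto
  finally have "b \<in> approx_set n \<xi> w"
    using b(1) a by (auto simp: approx_set_def m intro!: N_pos)
  then show False
    using b(1) by (auto simp: m a_def)
qed

end

section \<open>Comparison of all approximations with those in the base field\<close>

context laurent_extension
begin

lemma approx_set_mono: "w' \<le> w \<Longrightarrow> approx_set n \<xi> w \<subseteq> approx_set n \<xi> w'"
proof
  fix a
  assume "w' \<le> w" and a: "a \<in> approx_set n \<xi> w"
  have "N (j \<xi> - a) < alg_height emb a powr (- w - 1)"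
    using a by (simp add: approx_set_def)
  also have "\<dots> \<le> alg_height emb a powr (- w' - 1)"
    using \<open>w' \<le> w\<close> a alg_height_ge_1[of a]
    by (intro powr_mono) (auto simp: approx_set_def algebraic_le_def)
  finally show "a \<in> approx_set n \<xi> w'"
    using a by (simp add: approx_set_def)
qed

lemma rational_approx_exponent:
  assumes "1 \<le> n" and inf: "infinite (approx_set n \<xi> w)" and w': "w' < w"
  shows "\<exists>v\<ge>w'. infinite (approx_set n \<xi> v \<inter> range j)"
proof (cases "w' < - 1")
  case True
  then show ?thesis
    using infinite_rational_approx_below_minus_1[OF True assms(1)] by blast
next
  case False
  \<comment> \<open>The midpoint exceeds - 1 even if w' = - 1, and lies strictly below w: Liouville
    gives only w \<le> r - 1, while the construction requires a strict inequality.\<close>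
  define v where "v = (w' + w) / 2"
  have v: "w' \<le> v" "- 1 < v" "v < w"
    using False w' by (auto simp: v_def)
  have "infinite (approx_set n \<xi> v \<inter> range j)"
  proof (cases "algebraic_le n (j \<xi>)")
    case True
    then have "w \<le> real (alg_degree emb (j \<xi>)) - 1"
      using approx_exponent_le_of_algebraic[OF _ inf] by (simp add: algebraic_le_def)
    then show ?thesis
      using infinite_rational_approx_of_algebraic[OF True v(2)] v(3) by simp
  next
    case False
    have "infinite (approx_set n \<xi> w \<inter> range j)"
      using infinite_rational_approx_of_not_algebraic[OF False inf] v by simp
    moreover have "approx_set n \<xi> w \<inter> range j \<subseteq> approx_set n \<xi> v \<inter> range j"
      using approx_set_mono[of v w] v(3) by auto
    ultimately show ?thesis
      using finite_subset by blast
  qed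
  then show ?thesis
    using v(1) by blast
qed

end

subsection \<open>Change of the ambient field\<close>

definition approx_points ::
    "('a::{field,finite} poly \<Rightarrow> 'k::field) \<Rightarrow> ('k \<Rightarrow> real) \<Rightarrow> nat \<Rightarrow> 'k \<Rightarrow> real \<Rightarrow> 'k set" where
  "approx_points \<phi> av n \<xi> w = {\<alpha>. algebraic_via \<phi> \<alpha> \<and> alg_degree \<phi> \<alpha> \<le> n \<and>
     0 < av (\<xi> - \<alpha>) \<and> av (\<xi> - \<alpha>) < alg_height \<phi> \<alpha> powr (- w - 1)}"

lemma approx_exponent_eq:
  "approx_exponent \<phi> av n \<xi> = Sup (ereal ` {w. infinite (approx_points \<phi> av n \<xi> w)})"
  by (simp add: approx_exponent_def approx_points_def)

text \<open>By injectivity of g the predicates \<open>is_min_poly\<close> coincide as functions, so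
  the choices made in \<open>min_poly\<close> agree exactly.\<close>

lemma approx_points_hom:
  fixes \<phi> :: "'a::{field,finite} poly \<Rightarrow> 'k::field" and g :: "'k \<Rightarrow> 'l::field"
  assumes g: "field_hom g" and \<phi>: "\<phi> 0 = 0"
  shows "approx_points (\<lambda>R. g (\<phi> R)) av n (g \<xi>) w \<inter> range g =
    g ` approx_points \<phi> (\<lambda>y. av (g y)) n \<xi> w"
proof -
  interpret g: field_hom g
    by (rule g)
  have eval: "eval_at (\<lambda>R. g (\<phi> R)) P (g x) = 0 \<longleftrightarrow> eval_at \<phi> P x = 0" for P x
  proof -
    have "map_poly (\<lambda>R. g (\<phi> R)) P = map_poly g (map_poly \<phi> P)"
      using \<phi> by (simp add: map_poly_map_poly o_def)
    then show ?thesis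
      by (simp add: eval_at_def)
  qed
  have "is_min_poly (\<lambda>R. g (\<phi> R)) (g x) = is_min_poly \<phi> x" for x
    by (rule ext) (simp add: is_min_poly_def eval)
  then have "min_poly (\<lambda>R. g (\<phi> R)) (g x) = min_poly \<phi> x" for x
    by (simp add: min_poly_def)
  then have "g x \<in> approx_points (\<lambda>R. g (\<phi> R)) av n (g \<xi>) w \<longleftrightarrow>
      x \<in> approx_points \<phi> (\<lambda>y. av (g y)) n \<xi> w" for x
    by (simp add: approx_points_def algebraic_via_def eval alg_degree_def alg_height_def g.hom_minus)
  then show ?thesis
    by blast
qed

text \<open>f already splits over the algebraically closed field, so a larger field adds no roots.
  Hence algebraic points of the completion come from the algebraic closure.\<close>

lemma root_in_range_hom:
  fixes f :: "'k::alg_closed_field poly" and g :: "'k \<Rightarrow> 'l::field"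
  assumes "field_hom g" "f \<noteq> 0" "poly (map_poly g f) y = 0"
  shows "y \<in> range g"
proof -
  interpret g: field_hom g
    by (rule assms(1))
  interpret gp: map_poly_comm_ring_hom g ..
  show ?thesis
    using assms(2,3)
  proof (induction f rule: poly_split_induct)
    case (linear a f)
    have "map_poly g [:- a, 1:] = [:- g a, 1:]"
      by (simp add: Polynomial.map_poly_pCons g.hom_uminus)
    then have "(y - g a) * poly (map_poly g f) y = 0"
      using linear.prems(2) by (simp only: gp.hom_mult poly_linear_mult)
    then consider "y = g a" | "poly (map_poly g f) y = 0"
      by auto
    then show ?case
    proof cases
      case 2
      moreover have "f \<noteq> 0"
        using linear.prems(1) by auto
      ultimately show ?thesis
        using linear.IH by blast
    qed simp
  qed simp
qed

text \<open>The ultrametric inequality follows from the triangle inequality in characteristic p: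
  applied to p^k-th powers, which are additive, the latter bounds |x + y|^(p^k) by twice the p^k-th
  power of the maximum, and large k removes the factor 2.\<close>

lemma (in C_infinity) laurent_extension_av: "laurent_extension (\<lambda>x. av (\<iota> x)) to_ac"
proof
  have \<iota>_0: "\<iota> 0 = 0"
    using \<iota>_add[of 0 0] by (simp only: add_0_left add_cancel_right_right)
  have \<iota>_minus: "\<iota> (- x) = - \<iota> x" for x
    using \<iota>_add[of x "- x"] \<iota>_0 by (simp add: eq_neg_iff_add_eq_0 add.commute)
  have \<iota>_power: "\<iota> (x ^ n) = \<iota> x ^ n" for x n
    by (induction n) (simp_all add: \<iota>_one \<iota>_mult)
  have av_1: "av 1 = 1"
    using av_mult[of 1 1] av_eq_0_iff[of 1] by simp
  have av_power: "av (x ^ n) = av x ^ n" for x n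
    by (induction n) (simp_all add: av_1 av_mult)
  show "0 \<le> av (\<iota> x)" for x
    by (rule av_nonneg)
  show "av (\<iota> x) = 0 \<longleftrightarrow> x = 0" for x
  proof -
    have "\<iota> x \<noteq> 0" if "x \<noteq> 0"
      using \<iota>_mult[of x "inverse x"] \<iota>_one that by auto
    then show ?thesis
      using \<iota>_0 av_eq_0_iff by auto
  qed
  show "av (\<iota> (x * y)) = av (\<iota> x) * av (\<iota> y)" for x y
    by (simp add: \<iota>_mult av_mult)
  show "av (\<iota> (x + y)) \<le> max (av (\<iota> x)) (av (\<iota> y))" for x y
  proof (rule ccontr)
    define B where "B = max (av (\<iota> x)) (av (\<iota> y))"
    define s where "s = av (\<iota> (x + y))"
    assume "\<not> ?thesis"
    then have "B < s"
      unfolding B_def s_def by linarith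
    have "0 \<le> B"
      using av_nonneg[of "\<iota> x"] by (simp add: B_def)
    let ?p = "CHAR('a)"
    have prime: "prime CHAR('a fls alg_closure)"
      using prime_CHAR_finite_field[where 'a = 'a] by simp
    have bound: "s ^ (?p ^ k) \<le> 2 * B ^ (?p ^ k)" for k
    proof -
      have "s ^ (?p ^ k) = av (\<iota> ((x + y) ^ (?p ^ k)))"
        by (simp add: s_def \<iota>_power av_power)
      also have "(x + y) ^ (?p ^ k) = x ^ (?p ^ k) + y ^ (?p ^ k)"
        using freshmans_dream'[OF prime, of "?p ^ k" k x y] by simp
      also have "av (\<iota> (x ^ (?p ^ k) + y ^ (?p ^ k))) \<le> av (\<iota> x) ^ (?p ^ k) + av (\<iota> y) ^ (?p ^ k)"
        using av_triangle[of "\<iota> x ^ (?p ^ k)" "\<iota> y ^ (?p ^ k)"] by (simp add: \<iota>_add \<iota>_power av_power)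
      also have "\<dots> \<le> B ^ (?p ^ k) + B ^ (?p ^ k)"
        by (intro add_mono power_mono av_nonneg) (auto simp: B_def)
      finally show ?thesis
        by simp
    qed
    show False
    proof (cases "B = 0")
      case True
      then show False
        using bound[of 0] \<open>B < s\<close> by simp
    next
      case False
      then have "0 < B"
        using \<open>0 \<le> B\<close> by simp
      then have "1 < s / B"
        using \<open>B < s\<close> by simp
      then obtain k where k: "2 < (s / B) ^ k"
        using real_arch_pow by blast
      also have "\<dots> \<le> (s / B) ^ (?p ^ k)"
        using \<open>1 < s / B\<close> prime_gt_1_nat[OF prime_CHAR_finite_field[where 'a = 'a]]
        by (intro power_increasing less_imp_le[OF power_gt_expt]) auto
      finally show False
        using bound[of k] \<open>0 < B\<close> by (simp add: power_divide field_simps)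
    qed
  qed
  show "av (\<iota> (to_ac x)) = fls_abs x" for x
    by (rule av_extends)
qed simp_all

theorem theorem1p3:
  fixes p q k n :: nat
    and \<iota> :: "'a::{field,finite} fls alg_closure \<Rightarrow> 'c::{field,complete_space}"
    and av :: "'c \<Rightarrow> real"
    and \<xi> :: "'a fls"
  assumes "Factorial_Ring.prime p" and "k \<ge> 1" and "q = p ^ k" and "CARD('a) = q"
    and "C_infinity \<iota> av"
    and "n \<ge> 1"
  shows "w_star n \<xi> = w_at \<iota> av n \<xi>"
proof -
  interpret C: C_infinity \<iota> av
    by (rule assms(5))
  interpret L: laurent_extension "\<lambda>x. av (\<iota> x)" to_ac
    by (rule C.laurent_extension_av)
  have "\<iota> 0 = 0"
    using C.\<iota>_add[of 0 0] by (simp only: add_0_left add_cancel_right_right)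
  then have \<iota>: "field_hom \<iota>"
    by unfold_locales (simp_all add: C.\<iota>_add C.\<iota>_mult C.\<iota>_one)
  let ?A = "L.approx_set n \<xi>"
  have emb: "L.emb = (\<lambda>R. to_ac (poly_to_fls R))"
    by (simp add: fun_eq_iff L.emb_def)
  have A: "?A w = approx_points L.emb (\<lambda>x. av (\<iota> x)) n (to_ac \<xi>) w" for w
    by (simp add: L.approx_set_def approx_points_def L.algebraic_le_def conj_ac)
  have "approx_points poly_to_fls fls_abs n \<xi> w = approx_points poly_to_fls (\<lambda>x. av (\<iota> (to_ac x))) n \<xi> w" for w
    by (simp add: C.av_extends)
  then have "to_ac ` approx_points poly_to_fls fls_abs n \<xi> w = ?A w \<inter> range to_ac" for w
    unfolding A emb by (subst approx_points_hom) (simp_all add: L.j.field_hom_axioms)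
  then have star: "infinite (approx_points poly_to_fls fls_abs n \<xi> w) \<longleftrightarrow> infinite (?A w \<inter> range to_ac)" for w
    by (metis finite_image_iff inj_on_subset inj_to_ac subset_UNIV)
  have "approx_points (\<lambda>R. \<iota> (L.emb R)) av n (\<iota> (to_ac \<xi>)) w \<subseteq> range \<iota>" for w
  proof
    fix y
    assume "y \<in> approx_points (\<lambda>R. \<iota> (L.emb R)) av n (\<iota> (to_ac \<xi>)) w"
    then obtain P where "P \<noteq> 0" "eval_at (\<lambda>R. \<iota> (L.emb R)) P y = 0"
      by (auto simp: approx_points_def algebraic_via_def)
    moreover have "map_poly (\<lambda>R. \<iota> (L.emb R)) P = map_poly \<iota> (L.map_emb P)"
    proof -
      interpret i: field_hom \<iota>
        by (rule \<iota>)
      show ?thesis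
        by (simp add: map_poly_map_poly o_def)
    qed
    ultimately show "y \<in> range \<iota>"
      using root_in_range_hom[OF \<iota>, of "L.map_emb P" y] by (simp add: eval_at_def)
  qed
  then have "approx_points (\<lambda>R. \<iota> (L.emb R)) av n (\<iota> (to_ac \<xi>)) w = \<iota> ` ?A w" for w
    unfolding A using approx_points_hom[OF \<iota>, of L.emb av n "to_ac \<xi>" w] by (simp add: Int_absorb2)
  moreover have "inj \<iota>"
  proof -
    interpret i: field_hom \<iota>
      by (rule \<iota>)
    show ?thesis
      by (rule injI) simp
  qed
  ultimately have at: "infinite (approx_points (\<lambda>R. \<iota> (L.emb R)) av n (\<iota> (to_ac \<xi>)) w) \<longleftrightarrow> infinite (?A w)" for w
    by (metis finite_image_iff inj_on_subset subset_UNIV)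
  let ?W = "{w. infinite (?A w \<inter> range to_ac)}" and ?V = "{w. infinite (?A w)}"
  have "Sup (ereal ` ?W) = Sup (ereal ` ?V)"
  proof (rule antisym)
    show "Sup (ereal ` ?W) \<le> Sup (ereal ` ?V)"
      by (intro Sup_subset_mono image_mono) auto
    show "Sup (ereal ` ?V) \<le> Sup (ereal ` ?W)"
    proof (rule Sup_least, rule ccontr)
      fix x
      assume "x \<in> ereal ` ?V" and not_le: "\<not> x \<le> Sup (ereal ` ?W)"
      then obtain w where w: "x = ereal w" "infinite (?A w)"
        by blast
      \<comment> \<open>The gap below w provides the loss allowed in
        \<open>rational_approx_exponent\<close>.\<close>
      obtain w' where w': "Sup (ereal ` ?W) < ereal w'" "ereal w' < ereal w"
        using not_le w(1) ereal_dense2[of "Sup (ereal ` ?W)" "ereal w"] unfolding linorder_not_le by blast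
      then obtain v where "w' \<le> v" "v \<in> ?W"
        using L.rational_approx_exponent[OF assms(6) w(2), of w'] by auto
      then have "ereal w' \<le> Sup (ereal ` ?W)"
        by (intro Sup_upper2[of "ereal v"]) auto
      then show False
        using w'(1) by simp
    qed
  qed
  then show ?thesis
    unfolding w_star_def w_at_def approx_exponent_eq
    using star at by (simp add: emb)
qed

end
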